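(* Let $k\geq 2$ be a fixed integer and let $\epsilon \leq \frac{1}{2k}$ be a positive constant. Let $G$ be a graph of minimum degree $d$ and girth $2k+1$. Then for any tree $T$ of size at most $\frac14 \epsilon d^k$ and maximum degree $\Delta(T) \leq d - 2\epsilon d - 2$, Algorithm 3 (described in the context) succeeds in embedding $T$ in $G$ with high probability, i.e. with probability tending to $1$ as $d\to\infty$.
   Context: The girth of a graph is the length of its shortest cycle. An embedding of $T$ in $G$ is an injective map $f:V(T)\to V(G)$ mapping edges to edges. Algorithm 3: for each $v\in V(G)$ fix a set $N_+(v)\subseteq N(v)$ of exactly $d$ neighbors. Let $T$ be rooted at $r$. Starting from an arbitrary vertex $v_1\in V(G)$, make random moves, in each step choosing $v_{i+1}$ uniformly at random from $N_+(v_i)$, and embed the root at $f(r)=v_k$. As long as $T$ is not completely embedded, take an arbitrary vertex $s\in V(T)$ which is embedded but whose children are not. If $N_+(f(s))$ contains enough vertices not occupied by other vertices of $T$, embed the children of $s$ at distinct vertices chosen uniformly at random among these available vertices; otherwise the algorithm fails. *)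

theory Defs
  imports "HOL-Probability.Probability" "Graph_Theory.Graph_Theory"
begin

text \<open>
  A finite simple graph is a \<^locale>\<open>pair_graph\<close>: a symmetric, loop-free relation on a finite
  vertex set. The library's \<open>pre_digraph.cycle\<close> counts an edge traversed back and forth as a
  cycle of length 2 (so that its \<open>forest\<close> and \<open>tree\<close> are not the undirected notions); cycles of
  an undirected graph are exactly those of length at least 3.
\<close>

definition graph_cycle :: "'a pair_pre_digraph \<Rightarrow> ('a \<times> 'a) awalk \<Rightarrow> bool" where
  "graph_cycle G p \<longleftrightarrow> pre_digraph.cycle (with_proj G) p \<and> 3 \<le> length p"

definition girth :: "'a pair_pre_digraph \<Rightarrow> enat" where
  "girth G = (INF p\<in>{p. graph_cycle G p}. enat (length p))"

definition neighbors :: "'a pair_pre_digraph \<Rightarrow> 'a \<Rightarrow> 'a set" where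
  "neighbors G v = {w. (v, w) \<in> parcs G}"

definition degree :: "'a pair_pre_digraph \<Rightarrow> 'a \<Rightarrow> nat" where
  "degree G v = card (neighbors G v)"

definition min_degree :: "'a pair_pre_digraph \<Rightarrow> nat" where
  "min_degree G = Min (degree G ` pverts G)"

definition max_degree :: "'a pair_pre_digraph \<Rightarrow> nat" where
  "max_degree G = Max (degree G ` pverts G)"

definition undirected_tree :: "'a pair_pre_digraph \<Rightarrow> bool" where
  "undirected_tree T \<longleftrightarrow>
     pair_graph T \<and> Digraph_Component.connected (with_proj T) \<and> (\<nexists>p. graph_cycle T p)"

text \<open>In the tree \<open>T\<close> rooted at \<open>r\<close>, \<open>c\<close> is a child of \<open>s\<close> iff the path from \<open>r\<close> to \<open>c\<close>
  ends with the edge \<open>sc\<close>.\<close>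

definition children :: "'a pair_pre_digraph \<Rightarrow> 'a \<Rightarrow> 'a \<Rightarrow> 'a set" where
  "children T r s = {c. \<exists>p. pre_digraph.apath (with_proj T) r (p @ [(s, c)]) c}"

definition is_embedding ::
  "'t pair_pre_digraph \<Rightarrow> 'v pair_pre_digraph \<Rightarrow> ('t \<rightharpoonup> 'v) \<Rightarrow> bool" where
  "is_embedding T G f \<longleftrightarrow>
     dom f = pverts T \<and> ran f \<subseteq> pverts G \<and> inj_on f (dom f) \<and>
     (\<forall>(x, y)\<in>parcs T. (the (f x), the (f y)) \<in> parcs G)"

primrec random_walk :: "('v \<Rightarrow> 'v set) \<Rightarrow> nat \<Rightarrow> 'v \<Rightarrow> 'v list pmf" where
  "random_walk N 0 v = return_pmf [v]"
| "random_walk N (Suc n) v =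
     pmf_of_set (N v) \<bind> (\<lambda>w. map_pmf ((#) v) (random_walk N n w))"

text \<open>The vertices that may be processed next when the partial embedding is \<open>f\<close>. Children are
  always embedded all at once, so a vertex has either all or none of its children in \<open>dom f\<close>;
  leaves never need processing.\<close>

definition pending :: "'t pair_pre_digraph \<Rightarrow> 't \<Rightarrow> ('t \<rightharpoonup> 'v) \<Rightarrow> 't set" where
  "pending T r f = {s \<in> dom f. \<not> children T r s \<subseteq> dom f}"

text \<open>The arbitrary choice of the next vertex is a rule \<open>sel\<close> that sees the initial walk \<open>ws\<close> and
  the current partial embedding. For a fixed rule these determine the whole history
  of the run, so the rule may be adaptive.\<close>

definition selection_rule ::
  "'t pair_pre_digraph \<Rightarrow> 't \<Rightarrow> ('v list \<Rightarrow> ('t \<rightharpoonup> 'v) \<Rightarrow> 't) \<Rightarrow> bool" where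
  "selection_rule T r sel \<longleftrightarrow> (\<forall>ws f. pending T r f \<noteq> {} \<longrightarrow> sel ws f \<in> pending T r f)"

definition placements :: "'t set \<Rightarrow> 'v set \<Rightarrow> ('t \<rightharpoonup> 'v) set" where
  "placements C A = {g. dom g = C \<and> ran g \<subseteq> A \<and> inj_on g C}"

text \<open>\<^const>\<open>None\<close> is failure.\<close>

definition embed_children ::
  "'t pair_pre_digraph \<Rightarrow> 't \<Rightarrow> ('v \<Rightarrow> 'v set) \<Rightarrow> 't \<Rightarrow> ('t \<rightharpoonup> 'v) \<Rightarrow> ('t \<rightharpoonup> 'v) option pmf" where
  "embed_children T r N s f =
     (let C = children T r s; A = N (the (f s)) - ran f
      in if card C \<le> card A
         then map_pmf (\<lambda>g. Some (f ++ g)) (pmf_of_set (placements C A))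
         else return_pmf None)"

text \<open>At most \<open>n\<close> rounds; every round embeds at least one new vertex, so \<open>card (pverts T)\<close> rounds
  are enough for the algorithm to embed \<open>T\<close> or fail.\<close>

primrec embed_rounds ::
  "'t pair_pre_digraph \<Rightarrow> 't \<Rightarrow> ('v \<Rightarrow> 'v set) \<Rightarrow> (('t \<rightharpoonup> 'v) \<Rightarrow> 't) \<Rightarrow> nat \<Rightarrow> ('t \<rightharpoonup> 'v) \<Rightarrow>
    ('t \<rightharpoonup> 'v) option pmf" where
  "embed_rounds T r N sel 0 f = return_pmf (Some f)"
| "embed_rounds T r N sel (Suc n) f =
     (if dom f = pverts T then return_pmf (Some f)
      else embed_children T r N (sel f) f \<bind>
             (\<lambda>res. case res of None \<Rightarrow> return_pmf None
                              | Some f' \<Rightarrow> embed_rounds T r N sel n f'))"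

definition algorithm3 ::
  "'t pair_pre_digraph \<Rightarrow> 't \<Rightarrow> ('v \<Rightarrow> 'v set) \<Rightarrow> ('v list \<Rightarrow> ('t \<rightharpoonup> 'v) \<Rightarrow> 't) \<Rightarrow> nat \<Rightarrow> 'v \<Rightarrow>
    ('t \<rightharpoonup> 'v) option pmf" where
  "algorithm3 T r N sel k v1 =
     random_walk N (k - 1) v1 \<bind>
       (\<lambda>ws. embed_rounds T r N (sel ws) (card (pverts T)) [r \<mapsto> last ws])"

end

theory Submission
  imports Defs "HOL-Combinatorics.Transposition"
begin

text \<open>
  Fix the vertex \<open>v\<close> onto which a tree vertex \<open>s\<close> was embedded. Embedded paths do not backtrack and
  \<open>G\<close> has no cycle of length at most \<open>2k\<close>, so an embedded vertex in \<open>N(v)\<close> that is not a child of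
  \<open>s\<close> is the end of a chain of descendants of a tree vertex \<open>x\<close> at distance \<open>k\<close> from \<open>v\<close> that
  follows the unique shortest path towards \<open>v\<close>; each \<open>x\<close> yields at most one such vertex, and at most
  one further vertex has too few ancestors to have a full chain. In particular the position of the
  root is irrelevant. As long as no \<open>N(v)\<close> is hit more than \<open>b = \<lfloor>2\<epsilon>d\<rfloor>\<close> times, every step of a
  chain has probability at most \<open>p = 1 / (d - b)\<close>, so the product over all \<open>x\<close> of one plus the
  expected number of chains completed from \<open>x\<close> is a supermartingale, because a placement of children
  affects the chain of at most one \<open>x\<close>. It starts at no more than
  \<open>exp (|T| p^(k-1)) \<le> exp (\<epsilon>d)\<close>, whereas failure at \<open>v\<close> makes it at least \<open>2^(b-2)\<close>.

  The union bound cannot range over all \<open>v\<close>, since neither the order of \<open>G\<close> nor its in-degrees under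
  the sets \<open>N\<close> are bounded in terms of \<open>d\<close>. Two neighbours determine \<open>v\<close>, however, so once the
  first two chains towards \<open>v\<close> have started there are at most \<open>d^(2(k-1))\<close> possibilities for
  \<open>v\<close>. Tracking \<open>v\<close> only from then on, and not counting these two chains, leaves a sum
  over at most \<open>|T|^2 d^(2(k-1))\<close> supermartingales.
\<close>

section \<open>Walks without backtracking\<close>

definition nb_walk :: "'a rel \<Rightarrow> 'a list \<Rightarrow> bool" where
  "nb_walk E xs \<longleftrightarrow>
     (\<forall>i. Suc i < length xs \<longrightarrow> (xs ! i, xs ! Suc i) \<in> E) \<and>
     (\<forall>i. Suc (Suc i) < length xs \<longrightarrow> xs ! i \<noteq> xs ! Suc (Suc i))"

lemma nb_walk_singleton [simp]: "nb_walk E [x]"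
  by (simp add: nb_walk_def)

lemma nb_walk_Cons2:
  "nb_walk E (x # y # zs) \<longleftrightarrow> (x, y) \<in> E \<and> (zs \<noteq> [] \<longrightarrow> x \<noteq> hd zs) \<and> nb_walk E (y # zs)"
proof -
  have all_nat: "(\<forall>i. P i) \<longleftrightarrow> P 0 \<and> (\<forall>i. P (Suc i))" for P :: "nat \<Rightarrow> bool"
    by (metis not0_implies_Suc)
  have "(\<forall>i. Suc (Suc i) < length (x # y # zs) \<longrightarrow> (x # y # zs) ! i \<noteq> (x # y # zs) ! Suc (Suc i))
    \<longleftrightarrow> (zs \<noteq> [] \<longrightarrow> x \<noteq> hd zs) \<and>
        (\<forall>i. Suc (Suc i) < length (y # zs) \<longrightarrow> (y # zs) ! i \<noteq> (y # zs) ! Suc (Suc i))"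
    by (subst all_nat) (auto simp: hd_conv_nth)
  moreover have "(\<forall>i. Suc i < length (x # y # zs) \<longrightarrow> ((x # y # zs) ! i, (x # y # zs) ! Suc i) \<in> E)
    \<longleftrightarrow> (x, y) \<in> E \<and>
        (\<forall>i. Suc i < length (y # zs) \<longrightarrow> ((y # zs) ! i, (y # zs) ! Suc i) \<in> E)"
    by (subst all_nat) auto
  ultimately show ?thesis
    unfolding nb_walk_def by blast
qed

lemma nb_walk_rev:
  assumes "sym E" "nb_walk E xs"
  shows "nb_walk E (rev xs)"
  unfolding nb_walk_def
proof (intro conjI allI impI)
  fix i assume i: "Suc i < length (rev xs)"
  define j where "j = length xs - Suc (Suc i)"
  have "length xs - Suc i = Suc j" "Suc j < length xs"
    using i by (auto simp: j_def)
  then have "(xs ! j, xs ! Suc j) \<in> E"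
    using assms(2) by (simp add: nb_walk_def)
  then show "(rev xs ! i, rev xs ! Suc i) \<in> E"
    using i assms(1) \<open>length xs - Suc i = Suc j\<close>
    by (auto simp: rev_nth j_def[symmetric] dest: symD)
next
  fix i assume i: "Suc (Suc i) < length (rev xs)"
  define j where "j = length xs - Suc (Suc (Suc i))"
  have "length xs - Suc i = Suc (Suc j)" "Suc (Suc j) < length xs"
    using i by (auto simp: j_def)
  then have "xs ! j \<noteq> xs ! Suc (Suc j)"
    using assms(2) by (simp add: nb_walk_def)
  then show "rev xs ! i \<noteq> rev xs ! Suc (Suc i)"
    using i \<open>length xs - Suc i = Suc (Suc j)\<close> by (auto simp: rev_nth j_def[symmetric])
qed

lemma nb_walk_append:
  assumes "nb_walk E (xs @ [x])" "nb_walk E (x # ys)"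
    and "xs \<noteq> [] \<Longrightarrow> ys \<noteq> [] \<Longrightarrow> last xs \<noteq> hd ys"
  shows "nb_walk E (xs @ x # ys)"
  using assms
proof (induction xs)
  case (Cons a xs)
  show ?case
  proof (cases xs)
    case Nil
    then show ?thesis using Cons.prems by (auto simp: nb_walk_Cons2)
  next
    case (Cons b xs')
    with Cons.prems have "nb_walk E (xs @ [x])" "(a, b) \<in> E" "a \<noteq> hd (xs' @ [x])"
      by (auto simp: nb_walk_Cons2)
    moreover have "hd (xs' @ [x]) = hd (xs' @ x # ys)"
      by (cases xs') auto
    ultimately show ?thesis
      using Cons.IH Cons.prems Cons by (auto simp: nb_walk_Cons2)
  qed
qed simp

lemma pcas_append_arc: "pcas u (p @ [e]) v \<longleftrightarrow> pcas u p (fst e) \<and> snd e = v"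
  by (induction p arbitrary: u) auto

lemma pcas_map_upt: "pcas (g 0) (map (\<lambda>t. (g t, g (Suc t))) [0..<m]) (g m)"
  by (induction m) (auto simp: pcas_append_arc)

lemma pawalk_verts_map_upt:
  "pawalk_verts (g 0) (map (\<lambda>t. (g t, g (Suc t))) [0..<m]) = map g [0..<Suc m]"
proof -
  have "pawalk_verts u (p @ [e]) = pawalk_verts u p @ [snd e]" if "pcas u p (fst e)"
    for u p and e :: "'a \<times> 'a"
    using that by (induction p arbitrary: u) auto
  then show ?thesis
    by (induction m) (auto simp: pcas_map_upt)
qed

text \<open>Take a repetition with the smallest gap m. Minimality makes the vertices in between
  distinct, the absence of loops excludes m = 1 and non-backtracking excludes m = 2. What remains is
  a cycle of length m at most \<open>L\<close>.\<close>

lemma nb_walk_distinct: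
  assumes G: "pair_graph G"
    and girth: "enat L < girth G"
    and nb: "nb_walk (parcs G) xs" and len: "length xs \<le> Suc L"
  shows "distinct xs"
proof (rule ccontr)
  interpret pair_graph G by fact
  assume "\<not> distinct xs"
  define P where "P m \<longleftrightarrow> (\<exists>i. i + m < length xs \<and> 0 < m \<and> xs ! i = xs ! (i + m))" for m
  from \<open>\<not> distinct xs\<close> obtain i j where "i < j" "j < length xs" "xs ! i = xs ! j"
    by (metis distinct_conv_nth linorder_neqE_nat)
  then have "P (j - i)"
    by (auto simp: P_def intro!: exI[of _ i])
  define m where "m = (LEAST m. P m)"
  have "P m" and min: "\<And>m'. P m' \<Longrightarrow> m \<le> m'"
    using LeastI[of P, OF \<open>P (j - i)\<close>] Least_le[of P] by (auto simp: m_def)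
  then obtain i where i: "i + m < length xs" "0 < m" "xs ! i = xs ! (i + m)"
    by (auto simp: P_def)
  define g where "g t = xs ! (i + t)" for t
  have arc: "(g t, g (Suc t)) \<in> parcs G" if "t < m" for t
    using nb that i by (auto simp: nb_walk_def g_def)
  have "m \<noteq> 1"
    using arc[of 0] i(3) no_loops'[of "g 0" "g 1"] by (auto simp: g_def)
  moreover have "m \<noteq> 2"
    using nb i by (auto simp: nb_walk_def)
  ultimately have "3 \<le> m"
    using i(2) by linarith
  define p where "p = map (\<lambda>t. (g t, g (Suc t))) [0..<m]"
  have "g m = g 0"
    using i(3) by (simp add: g_def)
  have "distinct (map g [Suc 0..<Suc m])"
    unfolding distinct_map
  proof (intro conjI inj_onI)
    fix a b assume ab: "a \<in> set [Suc 0..<Suc m]" "b \<in> set [Suc 0..<Suc m]" "g a = g b"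
    have "False" if "a < b" "b \<le> m" "0 < a" "g a = g b" for a b
    proof -
      have "P (b - a)"
        using that i(1) by (auto simp: P_def g_def intro!: exI[of _ "i + a"])
      then show False using min[of "b - a"] that by auto
    qed
    from this[of a b] this[of b a] show "a = b"
      using ab by (metis atLeastLessThan_iff less_Suc_eq_le linorder_neqE_nat
          set_upt Suc_le_eq)
  qed simp
  moreover have "tl (pawalk_verts (g 0) p) = map g [Suc 0..<Suc m]"
    unfolding p_def pawalk_verts_map_upt by (simp add: map_tl[symmetric] upt_conv_Cons del: upt_Suc)
  moreover have "awalk (g 0) p (g 0)"
    unfolding awalk_def
    using \<open>3 \<le> m\<close> in_arcsD1[OF arc[of 0]] arc pcas_map_upt[of g m] \<open>g m = g 0\<close>
    by (auto simp: p_def)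
  moreover have "length p = m" by (simp add: p_def)
  ultimately have "graph_cycle G p"
    using \<open>3 \<le> m\<close> unfolding graph_cycle_def cycle_def by force
  then have "girth G \<le> enat m"
    unfolding girth_def \<open>length p = m\<close>[symmetric] by (intro INF_lower) simp
  with girth have "L < m"
    using less_le_trans by fastforce
  with i(1) len show False by simp
qed

text \<open>Strip the common beginning. At the first vertex where the walks part, the reverse of one
  followed by the other is again non-backtracking and short enough to be distinct, yet its two ends
  coincide.\<close>

lemma nb_walk_unique:
  assumes G: "pair_graph G"
    and girth: "enat L < girth G"
    and xs: "nb_walk (parcs G) (u # xs)" and ys: "nb_walk (parcs G) (u # ys)"
    and "last (u # xs) = last (u # ys)" and "length xs + length ys \<le> L"
  shows "xs = ys"
  using assms(3-)
proof (induction xs arbitrary: u ys)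
  case Nil
  have "distinct (u # ys)"
    using nb_walk_distinct[OF G girth Nil(2)] Nil(4) by auto
  with Nil(3) show ?case by (cases ys rule: rev_cases) auto
next
  case (Cons x xs)
  interpret pair_graph G by fact
  have symE: "sym (parcs G)"
    by (auto intro: symI arcs_symmetric)
  show ?case
  proof (cases ys)
    case Nil
    have "distinct (u # x # xs)"
      using nb_walk_distinct[OF G girth Cons(2)] Cons(5) by auto
    with Cons(4) Nil show ?thesis by (metis distinct.simps(2) last.simps last_in_set list.distinct(1))
  next
    case (Cons y ys')
    show ?thesis
    proof (cases "x = y")
      case True
      then show ?thesis
        using Cons.IH[of x ys'] Cons.prems Cons by (auto simp: nb_walk_Cons2)
    next
      case False
      have "nb_walk (parcs G) (rev (x # xs) @ [u])"
        using nb_walk_rev[OF symE Cons.prems(1)] by simp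
      then have "nb_walk (parcs G) (rev (x # xs) @ u # ys)"
        by (rule nb_walk_append[OF _ Cons.prems(2)]) (use False Cons in simp)
      then have "distinct (rev (x # xs) @ u # ys)"
        by (rule nb_walk_distinct[OF G girth]) (use Cons Cons.prems(4) in auto)
      then have "set (x # xs) \<inter> set ys = {}"
        by auto
      moreover have "last (x # xs) \<in> set (x # xs)"
        by (rule last_in_set) simp
      moreover have "last ys \<in> set ys"
        by (rule last_in_set) (simp add: Cons)
      moreover have "last (x # xs) = last ys"
        using Cons.prems(3) Cons by simp
      ultimately show ?thesis by auto
    qed
  qed
qed

section \<open>Distance levels in graphs of large girth\<close>

locale large_girth = pair_graph G for G :: "'v pair_pre_digraph" +
  fixes k :: nat
  assumes girth: "enat (2 * k) < girth G"
begin

text \<open>For i at most k this is the sphere of radius i around v. Non-backtracking walks replace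
  shortest paths because they can be extended and cut locally.\<close>

definition level :: "'v \<Rightarrow> nat \<Rightarrow> 'v set" where
  "level v i = {u. \<exists>xs. nb_walk (parcs G) (u # xs) \<and> last (u # xs) = v \<and> length xs = i}"

lemma levelI:
  "nb_walk (parcs G) (u # xs) \<Longrightarrow> last (u # xs) = v \<Longrightarrow> length xs = i \<Longrightarrow> u \<in> level v i"
  unfolding level_def by blast

lemma levelE:
  assumes "u \<in> level v i"
  obtains xs where "nb_walk (parcs G) (u # xs)" "last (u # xs) = v" "length xs = i"
  using assms unfolding level_def by blast

lemma level_0 [simp]: "level v 0 = {v}"
  by (auto simp: level_def)

lemma nb_walk_eq:
  assumes "nb_walk (parcs G) (u # xs)" "nb_walk (parcs G) (u # ys)"
    and "last (u # xs) = last (u # ys)" "length xs + length ys \<le> 2 * k"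
  shows "xs = ys"
  using nb_walk_unique[OF _ girth assms] pair_graph by blast

lemma level_1: "u \<in> level v 1 \<longleftrightarrow> (u, v) \<in> parcs G"
proof
  assume "u \<in> level v 1"
  then obtain xs where "nb_walk (parcs G) (u # xs)" "last (u # xs) = v" "length xs = 1"
    by (auto elim: levelE)
  then show "(u, v) \<in> parcs G"
    by (cases xs) (auto simp: nb_walk_Cons2)
next
  assume "(u, v) \<in> parcs G"
  then have "nb_walk (parcs G) (u # [v])"
    by (auto simp: nb_walk_Cons2)
  then show "u \<in> level v 1"
    unfolding level_def by (intro CollectI exI[of _ "[v]"]) auto
qed

lemma level_unique:
  assumes "u \<in> level v i" "u \<in> level v j" "i + j \<le> 2 * k"
  shows "i = j"
proof -
  from assms(1) obtain xs where "nb_walk (parcs G) (u # xs)" "last (u # xs) = v" "length xs = i"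
    by (rule levelE)
  moreover from assms(2) obtain ys where
    "nb_walk (parcs G) (u # ys)" "last (u # ys) = v" "length ys = j"
    by (rule levelE)
  ultimately have "xs = ys" "length xs = i" "length ys = j"
    using assms(3) by (auto intro: nb_walk_eq)
  then show ?thesis by simp
qed

text \<open>If w is the second vertex of the walk from u, dropping u gives a walk from w. Otherwise
  w can be put in front of u without backtracking.\<close>

lemma level_step:
  assumes "u \<in> level v i" "i < k" "(u, w) \<in> parcs G"
  shows "w \<in> level v (Suc i) \<or> (\<exists>j. i = Suc j \<and> w \<in> level v j)"
proof -
  from assms(1) obtain xs where
    xs: "nb_walk (parcs G) (u # xs)" "last (u # xs) = v" "length xs = i"
    by (auto elim: levelE)
  show ?thesis
  proof (cases "xs \<noteq> [] \<and> hd xs = w")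
    case True
    then obtain xs' where "xs = w # xs'"
      by (cases xs) auto
    with xs have "w \<in> level v (length xs')" "i = Suc (length xs')"
      by (auto simp: nb_walk_Cons2 intro!: levelI)
    then show ?thesis by blast
  next
    case False
    then have "nb_walk (parcs G) (w # u # xs)"
      using xs assms(3) by (auto simp: nb_walk_Cons2 arcs_symmetric)
    then have "w \<in> level v (Suc i)"
      using xs by (intro levelI) auto
    then show ?thesis ..
  qed
qed

text \<open>Walks to v through w and through w' both extend to u, and their total length 2 (i + 1)
  is within the range of uniqueness. This makes every step of a chain towards v forced.\<close>

lemma level_next_unique:
  assumes u: "u \<in> level v (Suc i)" and i: "Suc i \<le> k"
    and w: "w \<in> level v i" "(u, w) \<in> parcs G" and w': "w' \<in> level v i" "(u, w') \<in> parcs G"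
  shows "w = w'"
proof -
  have walk: "\<exists>xs. nb_walk (parcs G) (u # w # xs) \<and> last (w # xs) = v \<and> length xs = i"
    if w: "w \<in> level v i" "(u, w) \<in> parcs G" for w
  proof -
    from w obtain xs where xs: "nb_walk (parcs G) (w # xs)" "last (w # xs) = v" "length xs = i"
      by (auto elim: levelE)
    \<comment> \<open>Going straight back to u would put u on level i - 1 as well as on level i +
      1.\<close>
    have "u \<noteq> hd xs" if "xs \<noteq> []"
    proof
      assume "u = hd xs"
      with that obtain xs' where xs': "xs = u # xs'"
        by (cases xs) auto
      then have "u \<in> level v (i - 1)"
        using xs by (auto simp: nb_walk_Cons2 intro!: levelI)
      with u have "i - 1 = Suc i"
        using i by (intro level_unique) auto
      then show False by simp
    qed
    then have "nb_walk (parcs G) (u # w # xs)"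
      using xs(1) w(2) by (simp add: nb_walk_Cons2)
    with xs show ?thesis by blast
  qed
  obtain xs where "nb_walk (parcs G) (u # w # xs)" "last (w # xs) = v" "length xs = i"
    using walk[OF w] by blast
  moreover obtain ys where "nb_walk (parcs G) (u # w' # ys)" "last (w' # ys) = v" "length ys = i"
    using walk[OF w'] by blast
  ultimately have "w # xs = w' # ys"
    using i by (intro nb_walk_eq[of u]) simp_all
  then show ?thesis by simp
qed

text \<open>Otherwise there is a 4-cycle, seen here as two walks of length 2 from v to v'. The bound
  2 on k enters because 4 must not exceed 2k.\<close>

lemma common_neighbor_unique:
  assumes "2 \<le> k" "y \<noteq> y'"
    and "(v, y) \<in> parcs G" "(v, y') \<in> parcs G" "(v', y) \<in> parcs G" "(v', y') \<in> parcs G"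
  shows "v = v'"
proof (rule ccontr)
  assume "v \<noteq> v'"
  with assms have "nb_walk (parcs G) (v # [y, v'])" "nb_walk (parcs G) (v # [y', v'])"
    by (auto simp: nb_walk_Cons2 arcs_symmetric)
  then have "[y, v'] = [y', v']"
    using assms(1) by (intro nb_walk_eq) auto
  with assms(2) show False by simp
qed

end

section \<open>Rooted trees\<close>

locale rooted_tree = pair_graph T for T :: "'t pair_pre_digraph" +
  fixes r :: 't
  assumes tree: "undirected_tree T" and root_in: "r \<in> pverts T"
begin

abbreviation ch :: "'t \<Rightarrow> 't set" where "ch \<equiv> children T r"

text \<open>Makes \<open>nb_walk_unique\<close> applicable in \<open>T\<close> to walks of every
  length.\<close>

lemma girth_tree: "girth T = \<infinity>"
proof -
  have "{p. graph_cycle T p} = {}"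
    using tree unfolding undirected_tree_def by blast
  then show ?thesis
    unfolding girth_def \<open>{p. graph_cycle T p} = {}\<close> by (simp add: top_enat_def)
qed

lemma nb_walk_pawalk_verts:
  "pcas u p v \<Longrightarrow> set p \<subseteq> parcs T \<Longrightarrow> distinct (pawalk_verts u p) \<Longrightarrow> nb_walk (parcs T) (pawalk_verts u p)"
proof (induction p arbitrary: u)
  case (Cons e es)
  then have "nb_walk (parcs T) (pawalk_verts (snd e) es)"
    by simp
  moreover obtain zs where zs: "pawalk_verts (snd e) es = snd e # zs"
    using Cons.prems(1) by (cases es) auto
  moreover have "fst e \<notin> set zs"
    using Cons.prems(3) zs by auto
  ultimately show ?case
    using Cons.prems by (cases zs) (auto simp: nb_walk_Cons2)
qed simp

text \<open>Paths do not backtrack, so \<open>nb_walk_unique\<close> identifies their vertex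
  sequences, and the arcs can be read off from the vertices.\<close>

lemma apath_unique:
  assumes "apath u p v" "apath u q v"
  shows "p = q"
proof -
  have inj: "p = q" if "pawalk_verts u p = pawalk_verts u q" "pcas u p v" "pcas u q v" for u p q
    using that
  proof (induction p arbitrary: u q)
    case Nil
    then show ?case by (cases q) (auto dest: arg_cong[where f = length] simp: length_awalk_verts)
  next
    case (Cons e es)
    note Cons1 = this
    show ?case
    proof (cases q)
      case Nil
      with Cons.prems show ?thesis
        by (auto dest: arg_cong[where f = length] simp: length_awalk_verts)
    next
      case (Cons e' es')
      have "hd (pawalk_verts a p) = a" if "pcas a p v" for a p
        using that by (cases p) auto
      then have "snd e = snd e'"
        using Cons1 Cons by (metis list.inject pawalk_verts.simps(2) pcas.simps(2))
      with Cons1 Cons show ?thesis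
        by (auto intro: prod_eqI)
    qed
  qed
  have w: "\<exists>xs. pawalk_verts u p = u # xs \<and> nb_walk (parcs T) (u # xs) \<and> last (u # xs) = v \<and> pcas u p v"
    if "apath u p v" for p
  proof -
    have p: "pcas u p v" "set p \<subseteq> parcs T" "distinct (pawalk_verts u p)"
      using that by (auto simp: apath_def awalk_def)
    moreover obtain xs where "pawalk_verts u p = u # xs"
      using p(1) by (cases p) auto
    moreover have "last (pawalk_verts u p) = v"
      using p(1) by (rule awlast_if_cas)
    ultimately show ?thesis
      using nb_walk_pawalk_verts by force
  qed
  from w[OF assms(1)] w[OF assms(2)] obtain xs ys where
    xs: "pawalk_verts u p = u # xs" "nb_walk (parcs T) (u # xs)" "last (u # xs) = v" "pcas u p v"
    and ys: "pawalk_verts u q = u # ys" "nb_walk (parcs T) (u # ys)" "last (u # ys) = v" "pcas u q v"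
    by metis
  have "xs = ys"
    by (rule nb_walk_unique[where L = "length xs + length ys", OF _ _ xs(2) ys(2)])
      (use xs(3) ys(3) girth_tree pair_graph in auto)
  with xs ys show ?thesis
    using inj by metis
qed

lemma childrenE:
  assumes "c \<in> ch s"
  obtains p where "apath r (p @ [(s, c)]) c" "apath r p s" "(s, c) \<in> parcs T"
    "c \<notin> set (pawalk_verts r p)"
proof -
  from assms obtain p where p: "apath r (p @ [(s, c)]) c"
    by (auto simp: children_def)
  have last: "last (pawalk_verts r p) = s" "(s, c) \<in> parcs T" "awalk r p s"
    using p by (auto simp: apath_def awalk_simps)
  have "pawalk_verts r (p @ [(s, c)]) = pawalk_verts r p @ [c]"
    using p last by (subst awalk_verts_append) (auto simp: apath_def)
  then have "distinct (pawalk_verts r p @ [c])"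
    using p unfolding apath_def by metis
  then show ?thesis
    using that[of p] p last by (auto simp: apath_def)
qed

lemma childrenI:
  assumes "apath r p s" "(s, c) \<in> parcs T" "c \<notin> set (pawalk_verts r p)"
  shows "c \<in> ch s"
proof -
  have "awalk r (p @ [(s, c)]) c"
    using assms by (auto simp: apath_def awalk_simps in_arcsD2)
  moreover from this have "pawalk_verts r (p @ [(s, c)]) = pawalk_verts r p @ [c]"
    using assms(1) by (subst awalk_verts_append) (auto simp: apath_def)
  ultimately have "apath r (p @ [(s, c)]) c"
    using assms unfolding apath_def by simp
  then show ?thesis
    unfolding children_def by blast
qed

lemma children_arc: "c \<in> ch s \<Longrightarrow> (s, c) \<in> parcs T"
  by (elim childrenE)

lemma children_subset: "ch s \<subseteq> pverts T"
  using children_arc in_arcsD2 by blast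

lemma finite_children [simp, intro]: "finite (ch s)"
  using children_subset pair_finite_verts finite_subset by blast

lemma parent_in_verts: "c \<in> ch s \<Longrightarrow> s \<in> pverts T"
  using children_arc in_arcsD1 by blast

lemma parent_unique:
  assumes "c \<in> ch s" "c \<in> ch s'"
  shows "s = s'"
proof -
  from assms(1) obtain p where "apath r (p @ [(s, c)]) c" by (elim childrenE)
  moreover from assms(2) obtain q where "apath r (q @ [(s', c)]) c" by (elim childrenE)
  ultimately have "p @ [(s, c)] = q @ [(s', c)]"
    by (rule apath_unique)
  then show ?thesis by simp
qed

text \<open>The only path to s would have to pass through its own child c.\<close>

lemma children_asym:
  assumes "c \<in> ch s"
  shows "s \<notin> ch c"
proof
  assume "s \<in> ch c"
  then obtain q where q: "apath r (q @ [(c, s)]) s" by (elim childrenE)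
  from assms obtain p where p: "apath r p s" "c \<notin> set (pawalk_verts r p)"
    by (elim childrenE)
  from p(1) q have "p = q @ [(c, s)]"
    by (rule apath_unique)
  then have "c \<in> set (pawalk_verts r p)"
    using awalk_verts_arc1[of "(c, s)" p r] by simp
  with p(2) show False by simp
qed

lemma apath_exists:
  assumes "c \<in> pverts T"
  obtains p where "apath r p c"
proof -
  have "strongly_connected (with_proj T)"
    using tree sym_arcs by (intro symmetric_connected_imp_strongly_connected)
      (auto simp: undirected_tree_def)
  then have "reachable (with_proj T) r c"
    using assms root_in by (auto simp: strongly_connected_def)
  then show ?thesis
    using that by (auto simp: reachable_apath)
qed

lemma root_not_child: "r \<notin> ch s"
proof
  assume "r \<in> ch s"
  then obtain p where p: "apath r p s" "r \<notin> set (pawalk_verts r p)"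
    by (elim childrenE)
  then show False
    using hd_in_awalk_verts(2) by blast
qed

lemma parent_exists:
  assumes "c \<in> pverts T" "c \<noteq> r"
  obtains s where "c \<in> ch s"
proof -
  from assms(1) obtain p where p: "apath r p c"
    by (rule apath_exists)
  with assms(2) have "p \<noteq> []"
    by (auto simp: apath_simps)
  then obtain q e where q: "p = q @ [e]"
    by (cases p rule: rev_cases) auto
  then have "snd e = c"
    using p by (auto simp: apath_def awalk_simps)
  then have "c \<in> ch (fst e)"
    using p q unfolding children_def by (cases e) auto
  then show ?thesis by (rule that)
qed

lemma edge_parent:
  assumes "(x, y) \<in> parcs T"
  shows "y \<in> ch x \<or> x \<in> ch y"
proof -
  from assms obtain p where p: "apath r p x"
    using in_arcsD1 apath_exists by metis
  show ?thesis
  proof (cases "y \<in> set (pawalk_verts r p)")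
    case False
    then show ?thesis using childrenI[OF p assms] by blast
  next
    case True
    from p have "awalk r p x" by (simp add: apath_def)
    then obtain p1 p2 where p12: "p = p1 @ p2" "awalk r p1 y" "awalk y p2 x"
      using awalk_decomp[OF _ True] by metis
    then have a1: "apath r p1 y" and dis: "set (pawalk_verts r p1) \<inter> set (tl (pawalk_verts y p2)) = {}"
      using p by (auto simp: apath_append_iff)
    have "x \<noteq> y" using assms no_loops' by blast
    \<comment> \<open>Here the path to x passes through y. Its part beyond y contains x and avoids
      the part up to y, so x is a child of y.\<close>
    have "x \<in> set (tl (pawalk_verts y p2))"
    proof (cases p2)
      case (Cons e es)
      then have "awalk (snd e) es x"
        using p12(3) by (simp add: awalk_simps)
      then have "x = last (pawalk_verts (snd e) es)"
        by auto
      then show "x \<in> set (tl (pawalk_verts y p2))"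
        using Cons by simp
    qed (use p12(3) \<open>x \<noteq> y\<close> in \<open>simp add: awalk_simps\<close>)
    with dis have "x \<notin> set (pawalk_verts r p1)" by blast
    then show ?thesis
      using childrenI[OF a1 arcs_symmetric[OF assms]] by blast
  qed
qed

text \<open>Ensures that the algorithm never gets stuck: if no vertex is pending, all of
  \<open>T\<close> is embedded.\<close>

lemma children_closed_verts:
  assumes "r \<in> D" "\<And>s. s \<in> D \<Longrightarrow> ch s \<subseteq> D"
  shows "pverts T \<subseteq> D"
proof
  fix c assume "c \<in> pverts T"
  then obtain p where "apath r p c"
    by (rule apath_exists)
  then show "c \<in> D"
  proof (induction p arbitrary: c rule: rev_induct)
    case Nil
    then show ?case using assms(1) by (simp add: apath_simps)
  next
    case (snoc e p)
    then have "snd e = c"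
      by (auto simp: apath_def awalk_simps)
    then have "c \<in> ch (fst e)"
      using snoc.prems unfolding children_def by (cases e) auto
    moreover from this obtain q where "apath r (q @ [(fst e, c)]) c" "apath r q (fst e)"
      by (elim childrenE)
    moreover have "q @ [(fst e, c)] = p @ [e]"
      using calculation snoc.prems apath_unique by blast
    ultimately show ?case
      using snoc.IH[of "fst e"] assms(2) by auto
  qed
qed

end

section \<open>Uniform placements\<close>

lemma finite_placements [intro]:
  assumes "finite C" "finite A"
  shows "finite (placements C A)"
  by (rule finite_subset[OF _ finite_set_of_finite_maps[OF assms]]) (auto simp: placements_def)

lemma placements_nonempty:
  assumes "finite C" "finite A" "card C \<le> card A"
  shows "placements C A \<noteq> {}"
proof -
  obtain h where h: "inj_on h C" "h ` C \<subseteq> A"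
    using inj_on_iff_card_le[OF assms(1,2)] assms(3) by blast
  then have "(\<lambda>x. if x \<in> C then Some (h x) else None) \<in> placements C A"
    by (auto simp: placements_def ran_def inj_on_def split: if_splits)
  then show ?thesis by blast
qed

lemma placementsD:
  assumes "g \<in> placements C A"
  shows "dom g = C" "ran g \<subseteq> A" "inj_on g C" "\<And>c. c \<in> C \<Longrightarrow> the (g c) \<in> A"
    "\<And>c. c \<in> C \<Longrightarrow> g c = Some (the (g c))"
proof -
  show *: "dom g = C" "ran g \<subseteq> A" "inj_on g C"
    using assms by (auto simp: placements_def)
  show **: "g c = Some (the (g c))" if "c \<in> C" for c
    using that *(1) by auto
  show "the (g c) \<in> A" if "c \<in> C" for c
    using **[OF that] *(2) by (meson ranI subsetD)
qed

text \<open>Exchanging w and w' in the values of a placement is an injection between the two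
  sets.\<close>

lemma card_placements_le:
  assumes "finite C" "finite A" "c \<in> C" "w \<in> A" "w' \<in> A"
  shows "card {g \<in> placements C A. g c = Some w} \<le> card {g \<in> placements C A. g c = Some w'}"
proof (rule card_inj_on_le[where f = "\<lambda>g. map_option (Transposition.transpose w w') \<circ> g"])
  have inj: "inj (map_option (Transposition.transpose w w'))"
    by (intro option.inj_map inj_transpose)
  show "inj_on (\<lambda>g. map_option (Transposition.transpose w w') \<circ> g) {g \<in> placements C A. g c = Some w}"
    using inj by (intro inj_onI) (simp add: fun.inj_map_strong fun_eq_iff inj_eq)
  show "(\<lambda>g. map_option (Transposition.transpose w w') \<circ> g) ` {g \<in> placements C A. g c = Some w}
          \<subseteq> {g \<in> placements C A. g c = Some w'}"
  proof safe
    fix g assume g: "g \<in> placements C A" "g c = Some w"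
    show "(map_option (Transposition.transpose w w') \<circ> g) c = Some w'"
      using g by simp
    have "dom (map_option (Transposition.transpose w w') \<circ> g) = C"
      using placementsD(1)[OF g(1)] by (auto simp: dom_def)
    moreover have "ran (map_option (Transposition.transpose w w') \<circ> g) \<subseteq> A"
      using placementsD(2)[OF g(1)] assms by (auto simp: ran_def Transposition.transpose_def)
    moreover have "inj_on (map_option (Transposition.transpose w w') \<circ> g) C"
      using placementsD(3)[OF g(1)] inj by (intro comp_inj_on) (auto intro: inj_on_subset)
    ultimately show "map_option (Transposition.transpose w w') \<circ> g \<in> placements C A"
      by (simp add: placements_def)
  qed
  show "finite {g \<in> placements C A. g c = Some w'}"
    using finite_placements[OF assms(1,2)] by simp
qed

text \<open>The placements are split according to the value at c; by symmetry each of the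
  \<open>card A\<close> classes is equally large.\<close>

lemma card_placements_value:
  assumes "finite C" "finite A" "c \<in> C" "w \<in> A"
  shows "card A * card {g \<in> placements C A. g c = Some w} \<le> card (placements C A)"
proof -
  have "card A * card {g \<in> placements C A. g c = Some w}
      = (\<Sum>w'\<in>A. card {g \<in> placements C A. g c = Some w})"
    by simp
  also have "\<dots> \<le> (\<Sum>w'\<in>A. card {g \<in> placements C A. g c = Some w'})"
    by (intro sum_mono card_placements_le assms)
  also have "\<dots> = card (\<Union>w'\<in>A. {g \<in> placements C A. g c = Some w'})"
    using assms finite_placements[OF assms(1,2)] by (intro card_UN_disjoint[symmetric]) auto
  also have "\<dots> \<le> card (placements C A)"
    using finite_placements[OF assms(1,2)] by (intro card_mono) auto
  finally show ?thesis .
qed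

text \<open>W will be a level of v. A vertex one level further out has at most one neighbour on it,
  so hitting W means hitting one fixed vertex.\<close>

lemma card_placements_hit:
  assumes "finite C" "finite A" "A \<noteq> {}" "c \<in> C"
    and W: "\<And>w w'. w \<in> A \<inter> W \<Longrightarrow> w' \<in> A \<inter> W \<Longrightarrow> w = w'"
  shows "(\<Sum>g\<in>placements C A. of_bool (the (g c) \<in> W))
           \<le> (card (placements C A) / card A :: real)"
proof (cases "A \<inter> W = {}")
  case True
  then have "(\<Sum>g\<in>placements C A. of_bool (the (g c) \<in> W)) = (\<Sum>g\<in>placements C A. 0 :: real)"
    using placementsD(4)[OF _ \<open>c \<in> C\<close>] by (intro sum.cong) auto
  then show ?thesis by simp
next
  case False
  then obtain w where w: "A \<inter> W = {w}"
    using W by blast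
  have "(\<Sum>g\<in>placements C A. of_bool (the (g c) \<in> W)) =
        (\<Sum>g\<in>placements C A. of_bool (g c = Some w) :: real)"
  proof (intro sum.cong refl arg_cong[where f = of_bool])
    fix g assume g: "g \<in> placements C A"
    have "the (g c) \<in> A" "g c = Some (the (g c))"
      using placementsD(4,5)[OF g \<open>c \<in> C\<close>] by blast+
    moreover have "the (g c) \<in> W \<longleftrightarrow> the (g c) = w"
      using w calculation(1) by blast
    ultimately show "(the (g c) \<in> W) = (g c = Some w)"
      by (metis option.sel)
  qed
  also have "\<dots> = card {g \<in> placements C A. g c = Some w}"
    unfolding of_bool_def
    by (subst sum.inter_filter[symmetric]) (auto simp: finite_placements[OF assms(1,2)])
  also have "\<dots> \<le> card (placements C A) / card A"
  proof -
    have "real (card A * card {g \<in> placements C A. g c = Some w}) \<le> real (card (placements C A))"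
      using card_placements_value[of C A c w] assms w by (intro of_nat_mono) blast
    moreover have "card A > 0"
      using assms by (simp add: card_gt_0_iff)
    ultimately show ?thesis
      by (simp add: pos_le_divide_eq mult.commute)
  qed
  finally show ?thesis .
qed

section \<open>The supermartingale of a target vertex\<close>

text \<open>\<open>b\<close> is the number of occupied neighbours that is tolerated: the remaining d
  - b vertices always suffice for a set of children.\<close>

locale tree_embedding = GG: large_girth G k + TT: rooted_tree T r
  for G :: "'v pair_pre_digraph" and k and T :: "'t pair_pre_digraph" and r +
  fixes N :: "'v \<Rightarrow> 'v set" and d b :: nat
  assumes k: "2 \<le> k"
    and N_subset: "v \<in> pverts G \<Longrightarrow> N v \<subseteq> neighbors G v"
    and card_N: "v \<in> pverts G \<Longrightarrow> card (N v) = d"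
    and b: "2 \<le> b" "b < d"
    and children_bound: "card (children T r s) \<le> d - b"
begin

text \<open>Upper bound for the probability that a given child lands on a given vertex.\<close>

definition p :: real where "p = 1 / real (d - b)"

text \<open>This is p^j times the number of descendants of s at depth j, written recursively to
  match \<open>hit\<close>.\<close>

primrec wt :: "nat \<Rightarrow> 't \<Rightarrow> real" where
  "wt 0 s = 1"
| "wt (Suc j) s = (\<Sum>c\<in>TT.ch s. p * wt j c)"

text \<open>The expected number of descendants of an embedded \<open>s\<close> at depth \<open>j\<close> below it that will end up
  adjacent to \<open>v\<close> along a path approaching \<open>v\<close> in every step; a vertex not yet embedded
  contributes as if it and all its descendants followed that path with probability \<open>p\<close> per step.\<close>

primrec hit :: "('t \<rightharpoonup> 'v) \<Rightarrow> 'v \<Rightarrow> nat \<Rightarrow> 't \<Rightarrow> real" where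
  "hit f v 0 s = of_bool (the (f s) \<in> GG.level v 1)"
| "hit f v (Suc j) s = of_bool (the (f s) \<in> GG.level v (Suc (Suc j))) *
     (\<Sum>c\<in>TT.ch s. if c \<in> dom f then hit f v j c else p * wt j c)"

text \<open>The position of x itself is not charged a factor \<open>p\<close>: until it is embedded,
  x counts as if it were on level k. A completed chain from x makes the factor at least 2.\<close>

definition factor :: "('t \<rightharpoonup> 'v) \<Rightarrow> 'v \<Rightarrow> 't \<Rightarrow> real" where
  "factor f v x = 1 + (if x \<in> dom f then hit f v (k - 1) x else wt (k - 1) x)"

text \<open>\<open>D\<close> consists of the vertices embedded before \<open>v\<close> is tracked.\<close>

definition potential :: "'v \<Rightarrow> 't set \<Rightarrow> ('t \<rightharpoonup> 'v) \<Rightarrow> real" where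
  "potential v D f = (\<Prod>x\<in>pverts T - D. factor f v x)"

text \<open>The invariant of a run, established by \<open>valid_root\<close> and preserved by
  \<open>valid_ext\<close>.\<close>

definition valid :: "('t \<rightharpoonup> 'v) \<Rightarrow> bool" where
  "valid f \<longleftrightarrow> r \<in> dom f \<and> dom f \<subseteq> pverts T \<and> ran f \<subseteq> pverts G \<and> inj_on f (dom f) \<and>
     (\<forall>s c. c \<in> TT.ch s \<and> c \<in> dom f \<longrightarrow> s \<in> dom f \<and> the (f c) \<in> N (the (f s))) \<and>
     (\<forall>s\<in>dom f. TT.ch s \<subseteq> dom f \<or> TT.ch s \<inter> dom f = {})"

primrec descendants :: "nat \<Rightarrow> 't \<Rightarrow> 't set" where
  "descendants 0 x = {x}"
| "descendants (Suc m) x = (\<Union>c\<in>TT.ch x. descendants m c)"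

lemma p_nonneg [simp]: "0 \<le> p"
  by (simp add: p_def)

lemma wt_nonneg [simp]: "0 \<le> wt j s"
  by (induction j arbitrary: s) (auto intro!: sum_nonneg)

lemma hit_nonneg [simp]: "0 \<le> hit f v j s"
  by (induction j arbitrary: s) (auto intro!: sum_nonneg mult_nonneg_nonneg)

lemma factor_ge_1: "1 \<le> factor f v x"
  by (simp add: factor_def)

lemma factor_nonneg [simp]: "0 \<le> factor f v x"
  using factor_ge_1[of f v x] by linarith

lemma finite_N: "v \<in> pverts G \<Longrightarrow> finite (N v)"
  using card_N b by (metis card.infinite not_less_zero)

lemma N_arc: "v \<in> pverts G \<Longrightarrow> w \<in> N v \<Longrightarrow> (v, w) \<in> parcs G"
  using N_subset by (auto simp: neighbors_def)

lemma N_in_verts: "v \<in> pverts G \<Longrightarrow> w \<in> N v \<Longrightarrow> w \<in> pverts G"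
  using N_arc GG.in_arcsD2 by blast

lemma validD:
  assumes "valid f"
  shows "r \<in> dom f" "dom f \<subseteq> pverts T" "finite (dom f)" "ran f \<subseteq> pverts G" "finite (ran f)"
    "inj_on f (dom f)"
    "\<And>s c. c \<in> TT.ch s \<Longrightarrow> c \<in> dom f \<Longrightarrow> s \<in> dom f"
    "\<And>s c. c \<in> TT.ch s \<Longrightarrow> c \<in> dom f \<Longrightarrow> the (f c) \<in> N (the (f s))"
    "\<And>s. s \<in> dom f \<Longrightarrow> TT.ch s \<subseteq> dom f \<or> TT.ch s \<inter> dom f = {}"
    "\<And>x. x \<in> dom f \<Longrightarrow> the (f x) \<in> pverts G"
    "\<And>x y. x \<in> dom f \<Longrightarrow> y \<in> dom f \<Longrightarrow> the (f x) = the (f y) \<Longrightarrow> x = y"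
proof -
  show *: "r \<in> dom f" "dom f \<subseteq> pverts T" "ran f \<subseteq> pverts G" "inj_on f (dom f)"
    "\<And>s c. c \<in> TT.ch s \<Longrightarrow> c \<in> dom f \<Longrightarrow> s \<in> dom f"
    "\<And>s c. c \<in> TT.ch s \<Longrightarrow> c \<in> dom f \<Longrightarrow> the (f c) \<in> N (the (f s))"
    "\<And>s. s \<in> dom f \<Longrightarrow> TT.ch s \<subseteq> dom f \<or> TT.ch s \<inter> dom f = {}"
    using assms unfolding valid_def by blast+
  show "finite (dom f)" "finite (ran f)"
    using *(2,3) TT.pair_finite_verts GG.pair_finite_verts finite_subset by blast+
  show "the (f x) \<in> pverts G" if "x \<in> dom f" for x
    using that *(3) by (auto intro: ranI)
  show "x = y" if "x \<in> dom f" "y \<in> dom f" "the (f x) = the (f y)" for x y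
    using that *(4) by (metis domIff inj_onD option.expand)
qed

text \<open>Parents are unique, hence so is the ancestor m generations up. This is one half of the
  reason why a placement affects the chain of at most one x.\<close>

lemma descendants_unique:
  "s \<in> descendants m x \<Longrightarrow> s \<in> descendants m x' \<Longrightarrow> x = x'"
proof (induction m arbitrary: x x')
  case (Suc m)
  then obtain c c' where "c \<in> TT.ch x" "s \<in> descendants m c" "c' \<in> TT.ch x'" "s \<in> descendants m c'"
    by auto
  with Suc.IH[of c c'] show ?case
    using TT.parent_unique by blast
qed simp

definition avail :: "('t \<rightharpoonup> 'v) \<Rightarrow> 't \<Rightarrow> 'v set" where
  "avail f s = N (the (f s)) - ran f"

section \<open>One step of the run: placing the children of a pending vertex\<close>

context
  fixes f s
  assumes valid: "valid f" and s: "s \<in> pending T r f"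
begin

lemma s_dom: "s \<in> dom f" and children_fresh: "TT.ch s \<inter> dom f = {}" and children_ne: "TT.ch s \<noteq> {}"
  using s validD(9)[OF valid] by (auto simp: pending_def)

lemma fs_in_verts: "the (f s) \<in> pverts G"
  using validD(10)[OF valid s_dom] .

lemma finite_avail: "finite (avail f s)"
  using finite_N[OF fs_in_verts] by (simp add: avail_def)

abbreviation "P \<equiv> placements (TT.ch s) (avail f s)"

lemma finite_P: "finite P"
  using finite_placements[OF TT.finite_children finite_avail] .

lemma ext_dom: "g \<in> P \<Longrightarrow> dom (f ++ g) = dom f \<union> TT.ch s"
  by (simp only: dom_map_add placementsD(1)) (rule Un_commute)

lemma ext_old: "g \<in> P \<Longrightarrow> x \<in> dom f \<Longrightarrow> (f ++ g) x = f x"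
  using placementsD(1)[of g "TT.ch s" "avail f s"] children_fresh
  by (intro map_add_dom_app_simps(3)) blast

lemma ext_new: "g \<in> P \<Longrightarrow> c \<in> TT.ch s \<Longrightarrow> (f ++ g) c = g c"
  by (intro map_add_dom_app_simps(1)) (simp only: placementsD(1))

lemma ext_new_in: "g \<in> P \<Longrightarrow> c \<in> TT.ch s \<Longrightarrow> the (g c) \<in> N (the (f s)) - ran f"
  using placementsD(4)[of g "TT.ch s" "avail f s" c] by (simp add: avail_def)

lemma grandchildren_fresh:
  assumes "c \<in> TT.ch s"
  shows "TT.ch c \<inter> (dom f \<union> TT.ch s) = {}"
proof -
  have "c \<notin> dom f"
    using assms children_fresh by blast
  then show ?thesis
    using validD(7)[OF valid] TT.parent_unique[of _ s c] s_dom by blast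
qed

lemma valid_ext:
  assumes g: "g \<in> P"
  shows "valid (f ++ g)"
proof -
  define h where "h = f ++ g"
  have dom: "dom h = dom f \<union> TT.ch s"
    using ext_dom[OF g] by (simp add: h_def)
  have old: "h x = f x" if "x \<in> dom f" for x
    using ext_old[OF g that] by (simp add: h_def)
  have new: "h c = g c" if "c \<in> TT.ch s" for c
    using ext_new[OF g that] by (simp add: h_def)
  have new_in: "h c = Some (the (h c))" "the (h c) \<in> N (the (f s))" "the (h c) \<notin> ran f"
    if "c \<in> TT.ch s" for c
    using placementsD(5)[OF g that] ext_new_in[OF g that] new[OF that] by simp_all
  have "valid h"
    unfolding valid_def dom
  proof (intro conjI allI impI ballI)
    show "r \<in> dom f \<union> TT.ch s" "dom f \<union> TT.ch s \<subseteq> pverts T"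
      using validD(1,2)[OF valid] TT.children_subset by auto
    show "ran h \<subseteq> pverts G"
    proof
      fix w assume "w \<in> ran h"
      then obtain x where x: "h x = Some w"
        by (auto simp: ran_def)
      then have "x \<in> dom h" by auto
      then show "w \<in> pverts G"
        unfolding dom
      proof
        assume "x \<in> dom f"
        then show ?thesis using x old validD(4)[OF valid] by (metis ranI subsetD)
      next
        assume "x \<in> TT.ch s"
        then show ?thesis
          using x new_in(2) N_in_verts[OF fs_in_verts] by fastforce
      qed
    qed
    have "inj_on h (dom f)"
      using validD(6)[OF valid] old by (simp add: inj_on_def)
    moreover have "inj_on h (TT.ch s)"
      using placementsD(3)[OF g] new by (simp add: inj_on_def)
    moreover have "h x \<noteq> h c" if "x \<in> dom f" "c \<in> TT.ch s" for x c
      using old[OF that(1)] new_in(1,3)[OF that(2)] by (metis ranI)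
    ultimately show "inj_on h (dom f \<union> TT.ch s)"
      unfolding inj_on_Un by blast
  next
    fix s' c assume c: "c \<in> TT.ch s' \<and> c \<in> dom f \<union> TT.ch s"
    show "s' \<in> dom f \<union> TT.ch s"
      using c validD(7)[OF valid] TT.parent_unique[of c s s'] s_dom by blast
    show "the (h c) \<in> N (the (h s'))"
    proof (cases "c \<in> dom f")
      case True
      then have "s' \<in> dom f" "the (f c) \<in> N (the (f s'))"
        using c validD(7,8)[OF valid] by blast+
      with True show ?thesis using old by simp
    next
      case False
      then have "c \<in> TT.ch s" "s' = s"
        using c TT.parent_unique by blast+
      then show ?thesis
        using old[OF s_dom] new_in(2) by simp
    qed
  next
    fix x assume "x \<in> dom f \<union> TT.ch s"
    then show "TT.ch x \<subseteq> dom f \<union> TT.ch s \<or> TT.ch x \<inter> (dom f \<union> TT.ch s) = {}"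
    proof
      assume "x \<in> TT.ch s"
      then show ?thesis using grandchildren_fresh by blast
    next
      assume x: "x \<in> dom f"
      show ?thesis
      proof (cases "x = s")
        case False
        then have "TT.ch x \<inter> TT.ch s = {}"
          using TT.parent_unique by blast
        then show ?thesis using validD(9)[OF valid x] by blast
      qed simp
    qed
  qed
  then show ?thesis by (simp add: h_def)
qed

text \<open>No child of c is embedded yet, so the sum in \<open>hit\<close> reduces to the one in
  \<open>wt\<close>.\<close>

lemma hit_new:
  assumes g: "g \<in> P" and c: "c \<in> TT.ch s"
  shows "hit (f ++ g) v j c = of_bool (the (g c) \<in> GG.level v (Suc j)) * wt j c"
proof (cases j)
  case 0
  then show ?thesis using ext_new[OF g c] by simp
next
  case (Suc i)
  have "(\<Sum>c'\<in>TT.ch c. if c' \<in> dom (f ++ g) then hit (f ++ g) v i c' else p * wt i c') = wt j c"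
    unfolding Suc wt.simps ext_dom[OF g]
    using grandchildren_fresh[OF c] by (intro sum.cong) auto
  then show ?thesis
    unfolding Suc hit.simps ext_new[OF g c] by simp
qed

text \<open>In the recursion a descendant at depth m contributes only if it lies on level j - m + 1.
  If s is off the level required of it, its children never enter.\<close>

lemma hit_unchanged:
  assumes g: "g \<in> P"
  shows "x \<in> dom f \<Longrightarrow>
    (\<And>m. m \<le> j \<Longrightarrow> s \<in> descendants m x \<Longrightarrow> the (f s) \<notin> GG.level v (Suc (j - m))) \<Longrightarrow>
    hit (f ++ g) v j x = hit f v j x"
proof (induction j arbitrary: x)
  case 0
  then show ?case using ext_old[OF g] by simp
next
  case (Suc j)
  show ?case
  proof (cases "the (f x) \<in> GG.level v (Suc (Suc j))")
    case True
    then have "x \<noteq> s"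
      using Suc.prems(2)[of 0] by auto
    have "(\<Sum>c\<in>TT.ch x. if c \<in> dom (f ++ g) then hit (f ++ g) v j c else p * wt j c)
      = (\<Sum>c\<in>TT.ch x. if c \<in> dom f then hit f v j c else p * wt j c)"
    proof (intro sum.cong refl)
      fix c assume c: "c \<in> TT.ch x"
      then have "c \<notin> TT.ch s"
        using \<open>x \<noteq> s\<close> TT.parent_unique by blast
      moreover have "hit (f ++ g) v j c = hit f v j c" if "c \<in> dom f"
      proof (rule Suc.IH[OF that])
        fix m assume "m \<le> j" "s \<in> descendants m c"
        then show "the (f s) \<notin> GG.level v (Suc (j - m))"
          using Suc.prems(2)[of "Suc m"] c by auto
      qed
      ultimately show "(if c \<in> dom (f ++ g) then hit (f ++ g) v j c else p * wt j c)
        = (if c \<in> dom f then hit f v j c else p * wt j c)"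
        using ext_dom[OF g] by auto
    qed
    then show ?thesis
      unfolding hit.simps ext_old[OF g Suc.prems(1)] by simp
  next
    case False
    then show ?thesis
      unfolding hit.simps ext_old[OF g Suc.prems(1)] by simp
  qed
qed

text \<open>Embedding x off level k lowers its contribution to 0, and on level k it stays
  \<open>wt\<close>.\<close>

lemma factor_le:
  assumes g: "g \<in> P" and "x \<notin> dom f"
  shows "factor (f ++ g) v x \<le> factor f v x"
proof (cases "x \<in> TT.ch s")
  case True
  have "hit (f ++ g) v (k - 1) x \<le> wt (k - 1) x"
    unfolding hit_new[OF g True] by simp
  with True \<open>x \<notin> dom f\<close> show ?thesis
    unfolding factor_def ext_dom[OF g] by simp
next
  case False
  with \<open>x \<notin> dom f\<close> show ?thesis
    unfolding factor_def ext_dom[OF g] by simp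
qed

lemma factor_unchanged:
  assumes g: "g \<in> P" and x: "x \<in> dom f"
    and "\<And>m. m < k \<Longrightarrow> s \<in> descendants m x \<Longrightarrow> the (f s) \<notin> GG.level v (k - m)"
  shows "factor (f ++ g) v x = factor f v x"
proof -
  have "hit (f ++ g) v (k - 1) x = hit f v (k - 1) x"
  proof (rule hit_unchanged[OF g x])
    fix m assume "m \<le> k - 1" "s \<in> descendants m x"
    moreover from this have "Suc (k - 1 - m) = k - m" "m < k"
      using k by auto
    ultimately show "the (f s) \<notin> GG.level v (Suc (k - 1 - m))"
      using assms(3)[of m] by metis
  qed
  then show ?thesis
    using x ext_dom[OF g] by (simp add: factor_def)
qed

context
  assumes avail: "d - b \<le> card (avail f s)"
begin

lemma card_avail_pos: "0 < card (avail f s)"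
  using avail b by simp

lemma P_nonempty: "P \<noteq> {}"
  using placements_nonempty[OF TT.finite_children finite_avail]
    le_trans[OF children_bound avail] .

text \<open>An expectation over the uniform placement, multiplied by \<open>card P\<close>. In the
  induction a child is either embedded already, or placed right now, or still unaffected; only the
  second case involves a new probability.\<close>

lemma hit_supermartingale:
  "x \<in> dom f \<Longrightarrow> j < k \<Longrightarrow> (\<Sum>g\<in>P. hit (f ++ g) v j x) \<le> card P * hit f v j x"
proof (induction j arbitrary: x)
  case 0
  have "(\<Sum>g\<in>P. hit (f ++ g) v 0 x) = (\<Sum>g\<in>P. hit f v 0 x)"
    using ext_old[OF _ 0(1)] by (intro sum.cong) auto
  then show ?case by simp
next
  case (Suc j)
  show ?case
  proof (cases "the (f x) \<in> GG.level v (Suc (Suc j))")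
    case True
    let ?h = "\<lambda>f c. if c \<in> dom f then hit f v j c else p * wt j c"
    have "(\<Sum>g\<in>P. hit (f ++ g) v (Suc j) x) = (\<Sum>g\<in>P. \<Sum>c\<in>TT.ch x. ?h (f ++ g) c)"
      using ext_old[OF _ Suc.prems(1)] True by (intro sum.cong) auto
    also have "\<dots> = (\<Sum>c\<in>TT.ch x. \<Sum>g\<in>P. ?h (f ++ g) c)"
      by (rule sum.swap)
    also have "\<dots> \<le> (\<Sum>c\<in>TT.ch x. card P * ?h f c)"
    proof (rule sum_mono)
      fix c assume c: "c \<in> TT.ch x"
      consider "c \<in> dom f" | "c \<notin> dom f" "x = s" | "c \<notin> dom f" "x \<noteq> s" by blast
      then show "(\<Sum>g\<in>P. ?h (f ++ g) c) \<le> card P * ?h f c"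
      proof cases
        case 1
        then have "(\<Sum>g\<in>P. ?h (f ++ g) c) = (\<Sum>g\<in>P. hit (f ++ g) v j c)"
          using ext_dom by (intro sum.cong) auto
        then show ?thesis
          using Suc.IH[OF 1] Suc.prems 1 by simp
      next
        case 2
        then have "c \<in> TT.ch s" using c by simp
        have "(\<Sum>g\<in>P. ?h (f ++ g) c)
            = (\<Sum>g\<in>P. of_bool (the (g c) \<in> GG.level v (Suc j)) * wt j c)"
          using ext_dom \<open>c \<in> TT.ch s\<close> hit_new by (intro sum.cong) auto
        also have "\<dots> = (\<Sum>g\<in>P. of_bool (the (g c) \<in> GG.level v (Suc j))) * wt j c"
          by (simp add: sum_distrib_right)
        \<comment> \<open>The image of s is on level j + 2, so at most one available vertex is on
          level j + 1. With at least d - b available vertices its probability is at most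
          \<open>p\<close>.\<close>
        also have "\<dots> \<le> card P / card (avail f s) * wt j c"
        proof (intro mult_right_mono card_placements_hit finite_avail TT.finite_children \<open>c \<in> TT.ch s\<close>)
          show "avail f s \<noteq> {}" using card_avail_pos by auto
          fix w w' assume "w \<in> avail f s \<inter> GG.level v (Suc j)" "w' \<in> avail f s \<inter> GG.level v (Suc j)"
          then show "w = w'"
            using GG.level_next_unique[of "the (f s)" v "Suc j" w w'] True 2 Suc.prems
              N_arc[OF fs_in_verts] by (auto simp: avail_def)
        qed simp
        also have "\<dots> \<le> card P * p * wt j c"
        proof (intro mult_right_mono)
          have "1 / real (card (avail f s)) \<le> p"
            unfolding p_def using avail b by (intro divide_left_mono) auto
          then show "card P / card (avail f s) \<le> card P * p"
            using mult_left_mono[of "1 / card (avail f s)" p "card P"] by simp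
        qed simp
        finally show ?thesis using 2 by (simp add: mult.assoc)
      next
        case 3
        then have "c \<notin> TT.ch s"
          using c TT.parent_unique by blast
        then have "(\<Sum>g\<in>P. ?h (f ++ g) c) = (\<Sum>g\<in>P. p * wt j c)"
          using ext_dom 3 by (intro sum.cong) auto
        then show ?thesis using 3 by simp
      qed
    qed
    also have "\<dots> = card P * hit f v (Suc j) x"
      using True by (simp add: sum_distrib_left)
    finally show ?thesis .
  next
    case False
    then have "(\<Sum>g\<in>P. hit (f ++ g) v (Suc j) x) = (\<Sum>g\<in>P. 0)"
      using ext_old[OF _ Suc.prems(1)] by (intro sum.cong) auto
    with False show ?thesis
      by (simp del: hit.simps(2))
  qed
qed

text \<open>The factors are not independent, but at most one can increase: the level of the image of
  s determines the depth m, and m determines the ancestor \<open>x0\<close>. The other factors do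
  not increase for any g, so they come out as constants and the expectation of a single factor
  remains.\<close>

lemma potential_supermartingale:
  "(\<Sum>g\<in>P. potential v D (f ++ g)) \<le> card P * potential v D f"
proof (cases "\<exists>x\<in>(pverts T - D) \<inter> dom f. \<exists>m<k. s \<in> descendants m x \<and> the (f s) \<in> GG.level v (k - m)")
  case False
  have "factor (f ++ g) v x \<le> factor f v x" if "g \<in> P" "x \<in> pverts T - D" for g x
  proof (cases "x \<in> dom f")
    case True
    then have "factor (f ++ g) v x = factor f v x"
      using False that by (intro factor_unchanged) blast+
    then show ?thesis by simp
  qed (rule factor_le[OF that(1)])
  then have "(\<Sum>g\<in>P. potential v D (f ++ g)) \<le> (\<Sum>g\<in>P. potential v D f)"
    unfolding potential_def by (intro sum_mono prod_mono) auto
  then show ?thesis by simp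
next
  case True
  then obtain x0 m0 where x0: "x0 \<in> pverts T - D" "x0 \<in> dom f" "m0 < k"
    "s \<in> descendants m0 x0" "the (f s) \<in> GG.level v (k - m0)" by blast
  have other: "factor (f ++ g) v x \<le> factor f v x" if g: "g \<in> P" and "x \<noteq> x0" for g x
  proof (cases "x \<in> dom f")
    case True
    have "factor (f ++ g) v x = factor f v x"
    proof (rule factor_unchanged[OF g True])
      fix m assume m: "m < k" "s \<in> descendants m x"
      show "the (f s) \<notin> GG.level v (k - m)"
      proof
        assume "the (f s) \<in> GG.level v (k - m)"
        then have "k - m = k - m0"
          using x0(5) by (intro GG.level_unique) auto
        then have "m = m0"
          using m x0 by simp
        then show False
          using descendants_unique[of s m x x0] m x0 that(2) by simp
      qed
    qed
    then show ?thesis by simp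
  qed (simp add: factor_le[OF g])
  let ?C = "\<Prod>x\<in>pverts T - D - {x0}. factor f v x"
  have split: "potential v D f' = factor f' v x0 * (\<Prod>x\<in>pverts T - D - {x0}. factor f' v x)" for f'
    unfolding potential_def using x0(1) TT.pair_finite_verts by (intro prod.remove) auto
  have "(\<Sum>g\<in>P. potential v D (f ++ g)) \<le> (\<Sum>g\<in>P. factor (f ++ g) v x0 * ?C)"
    unfolding split using other by (intro sum_mono mult_left_mono prod_mono) auto
  also have "\<dots> = (\<Sum>g\<in>P. 1 + hit (f ++ g) v (k - 1) x0) * ?C"
    unfolding sum_distrib_right[symmetric] using x0(2) ext_dom
    by (intro arg_cong2[where f = "(*)"] sum.cong) (auto simp: factor_def)
  also have "\<dots> \<le> card P * (1 + hit f v (k - 1) x0) * ?C"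
    using hit_supermartingale[OF x0(2), of "k - 1" v] k
    by (intro mult_right_mono prod_nonneg) (auto simp: sum.distrib algebra_simps)
  also have "\<dots> = card P * potential v D f"
    unfolding split using x0(2) by (simp add: factor_def)
  finally show ?thesis .
qed

end

end

section \<open>Counting occupied neighbours\<close>

text \<open>The set-valued counterpart of \<open>hit\<close>, restricted to chains that are embedded
  entirely. It contains their last vertices.\<close>

primrec completed :: "('t \<rightharpoonup> 'v) \<Rightarrow> 'v \<Rightarrow> nat \<Rightarrow> 't \<Rightarrow> 't set" where
  "completed f v 0 x = (if x \<in> dom f \<and> the (f x) \<in> GG.level v 1 then {x} else {})"
| "completed f v (Suc j) x = (if x \<in> dom f \<and> the (f x) \<in> GG.level v (Suc (Suc j))
     then \<Union>c\<in>TT.ch x. completed f v j c else {})"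

text \<open>Where a chain from \<open>u\<close> towards \<open>v\<close> can end. Unlike \<open>completed\<close> this depends only on \<open>G\<close>, so
  for a fixed set of embedded vertices it does not change during the run.\<close>

primrec ends :: "'v \<Rightarrow> nat \<Rightarrow> 'v \<Rightarrow> 'v set" where
  "ends v 0 u = {u} \<inter> GG.level v 1"
| "ends v (Suc j) u = (if u \<in> GG.level v (Suc (Suc j)) then \<Union>w\<in>N u. ends v j w else {})"

text \<open>A superset of \<open>ends\<close> that does not mention v, so that ends can be counted
  before the target is known.\<close>

primrec reach :: "nat \<Rightarrow> 'v \<Rightarrow> 'v set" where
  "reach 0 u = {u}"
| "reach (Suc j) u = (\<Union>w\<in>N u. reach j w)"

lemma completed_level:
  "y \<in> completed f v j x \<Longrightarrow> x \<in> dom f \<and> the (f x) \<in> GG.level v (Suc j)"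
  by (cases j) (auto split: if_splits)

lemma completed_dom: "y \<in> completed f v j x \<Longrightarrow> y \<in> dom f"
  by (induction j arbitrary: x) (auto split: if_splits)

lemma ends_level: "w \<in> ends v j u \<Longrightarrow> u \<in> GG.level v (Suc j)"
  by (cases j) (auto split: if_splits)

lemma ends_level_1: "w \<in> ends v j u \<Longrightarrow> w \<in> GG.level v 1"
  by (induction j arbitrary: u) (auto split: if_splits)

lemma ends_reach: "ends v j u \<subseteq> reach j u"
  by (induction j arbitrary: u) (auto split: if_splits)

lemma ends_unique:
  "u \<in> pverts G \<Longrightarrow> j < k \<Longrightarrow> w \<in> ends v j u \<Longrightarrow> w' \<in> ends v j u \<Longrightarrow> w = w'"
proof (induction j arbitrary: u)
  case (Suc j)
  then obtain z z' where z: "z \<in> N u" "w \<in> ends v j z" "z' \<in> N u" "w' \<in> ends v j z'"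
    and u: "u \<in> GG.level v (Suc (Suc j))"
    by (auto split: if_splits)
  have "z \<in> GG.level v (Suc j)" "z' \<in> GG.level v (Suc j)"
    using z ends_level by blast+
  then have "z = z'"
    using u Suc.prems(1,2) z N_arc by (intro GG.level_next_unique[of u v "Suc j" z z']) simp_all
  with z Suc.IH[of z] Suc.prems(1,2) show ?case
    using N_in_verts by simp
qed simp

lemma finite_ends:
  assumes "u \<in> pverts G" "j < k"
  shows "finite (ends v j u)"
proof (cases "ends v j u = {}")
  case False
  then obtain w where "w \<in> ends v j u" by blast
  then have "ends v j u \<subseteq> {w}"
    using ends_unique[OF assms] by blast
  then show ?thesis using finite_subset by blast
qed simp

lemma finite_reach: "u \<in> pverts G \<Longrightarrow> finite (reach j u)"
  and card_reach: "u \<in> pverts G \<Longrightarrow> card (reach j u) \<le> d ^ j"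
proof (induction j arbitrary: u)
  case (Suc j)
  case 1
  then show ?case
    using finite_N Suc N_in_verts by auto
next
  case (Suc j)
  case 2
  have "card (reach (Suc j) u) \<le> (\<Sum>w\<in>N u. card (reach j w))"
    using finite_N[OF 2] by (simp add: card_UN_le)
  also have "\<dots> \<le> (\<Sum>w\<in>N u. d ^ j)"
    using Suc N_in_verts[OF 2] by (intro sum_mono) auto
  finally show ?case
    using card_N[OF 2] by simp
qed simp_all

lemma completed_ends:
  assumes f: "valid f"
  shows "y \<in> completed f v j x \<Longrightarrow> the (f y) \<in> ends v j (the (f x))"
proof (induction j arbitrary: x)
  case 0
  then show ?case by (auto split: if_splits)
next
  case (Suc j)
  then obtain c where c: "c \<in> TT.ch x" "y \<in> completed f v j c"
    and x: "the (f x) \<in> GG.level v (Suc (Suc j))"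
    by (auto split: if_splits)
  have "the (f c) \<in> N (the (f x))"
    using validD(8)[OF f c(1)] completed_level[OF c(2)] by blast
  then show ?case
    using Suc.IH[OF c(2)] x by auto
qed

text \<open>A chain towards v is forced in \<open>G\<close>, so its end is determined there, and f
  is injective.\<close>

lemma completed_unique:
  assumes f: "valid f" and "j < k" and y: "y \<in> completed f v j x" "y' \<in> completed f v j x"
  shows "y = y'"
proof -
  have "the (f x) \<in> pverts G"
    using completed_level[OF y(1)] validD(10)[OF f] by blast
  then have "the (f y) = the (f y')"
    using completed_ends[OF f y(1)] completed_ends[OF f y(2)] assms(2) by (intro ends_unique)
  then show ?thesis
    using validD(11)[OF f] completed_dom y by blast
qed

lemma completed_hit: "y \<in> completed f v j x \<Longrightarrow> 1 \<le> hit f v j x"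
proof (induction j arbitrary: x)
  case 0
  then show ?case by (auto split: if_splits)
next
  case (Suc j)
  then obtain c where c: "c \<in> TT.ch x" "y \<in> completed f v j c"
    and x: "the (f x) \<in> GG.level v (Suc (Suc j))"
    by (auto split: if_splits)
  let ?h = "\<lambda>c. if c \<in> dom f then hit f v j c else p * wt j c"
  have "1 \<le> ?h c"
    using Suc.IH[OF c(2)] completed_level[OF c(2)] by simp
  also have "\<dots> \<le> sum ?h (TT.ch x)"
    using c(1) by (intro member_le_sum) auto
  finally show ?case using x by simp
qed

lemma finite_completed [simp]: "finite (completed f v j x)"
  by (induction j arbitrary: x) auto

definition all_ends :: "('t \<rightharpoonup> 'v) \<Rightarrow> 'v \<Rightarrow> 't set \<Rightarrow> 'v set" where
  "all_ends f v D = (\<Union>x\<in>D \<inter> dom f. ends v (k - 1) (the (f x)))"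

lemma finite_all_ends: "valid f \<Longrightarrow> finite (all_ends f v D)"
  unfolding all_ends_def using validD(3,10) finite_ends k by auto

text \<open>Climb from y through its ancestors. Each parent turns out to be one level further out,
  so the chain grows until it starts on level k or at the root.\<close>

lemma level_1_completed:
  assumes f: "valid f" and s: "s \<in> pending T r f" and v: "v = the (f s)"
    and y: "y \<in> dom f" "the (f y) \<in> GG.level v 1"
  shows "(\<exists>m<k - 1. y \<in> completed f v m r) \<or> (\<exists>x\<in>dom f. y \<in> completed f v (k - 1) x)"
proof -
  have "(\<exists>m'<m. y \<in> completed f v m' r) \<or> (\<exists>x\<in>dom f. y \<in> completed f v m x)" if "m < k" for m
    using that
  proof (induction m)
    case 0
    then show ?case using y by auto
  next
    case (Suc m)
    then consider "\<exists>m'<m. y \<in> completed f v m' r" | x where "x \<in> dom f" "y \<in> completed f v m x"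
      by auto
    then show ?case
    proof cases
      case 1
      then show ?thesis using less_SucI by blast
    next
      case 2
      show ?thesis
      proof (cases "x = r")
        case True
        then show ?thesis using 2 by blast
      next
        case False
        then obtain z where z: "x \<in> TT.ch z"
          using TT.parent_exists validD(2)[OF f] 2 by blast
        have "z \<in> dom f" and x_in: "the (f x) \<in> N (the (f z))"
          using validD(7,8)[OF f z] 2 by blast+
        then have arc: "(the (f x), the (f z)) \<in> parcs G"
          using N_arc validD(10)[OF f] GG.arcs_symmetric by blast
        have x_level: "the (f x) \<in> GG.level v (Suc m)"
          using completed_level[OF 2(2)] by blast
        \<comment> \<open>The parent z of x cannot be closer to v. If m = 0, z would sit on v and be
          s, whose children are not embedded. If m > 0, z would sit on the same vertex as the next
          vertex c of the chain, which is a child of x.\<close>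
        have "the (f z) \<notin> GG.level v m"
        proof
          assume z_level: "the (f z) \<in> GG.level v m"
          show False
          proof (cases m)
            case 0
            then have "z = s"
              using z_level v validD(11)[OF f] \<open>z \<in> dom f\<close> s by (simp add: pending_def)
            then show False
              using children_fresh[OF f s] z 2 by blast
          next
            case (Suc i)
            then obtain c where c: "c \<in> TT.ch x" "y \<in> completed f v i c"
              using 2(2) by (auto split: if_splits)
            then have c_level: "c \<in> dom f" "the (f c) \<in> GG.level v m"
              using completed_level[OF c(2)] Suc by blast+
            have "(the (f x), the (f c)) \<in> parcs G"
              using validD(8)[OF f c(1) c_level(1)] N_arc validD(10)[OF f] 2(1) by blast
            then have "the (f z) = the (f c)"
              using arc z_level c_level x_level \<open>Suc m < k\<close>
              by (intro GG.level_next_unique[of "the (f x)" v m]) auto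
            then have "z = c"
              using validD(11)[OF f] \<open>z \<in> dom f\<close> c_level by blast
            then show False
              using TT.children_asym z c by blast
          qed
        qed
        then have "the (f z) \<in> GG.level v (Suc (Suc m))"
          using GG.level_step[OF x_level \<open>Suc m < k\<close> arc] by auto
        then have "y \<in> completed f v (Suc m) z"
          using \<open>z \<in> dom f\<close> z 2 by auto
        then show ?thesis
          using \<open>z \<in> dom f\<close> by blast
      qed
    qed
  qed
  from this[of "k - 1"] show ?thesis using k by simp
qed

text \<open>The level of the root's image fixes the length m, and \<open>completed_unique\<close>
  then fixes the end.\<close>

lemma card_completed_root:
  assumes f: "valid f"
  shows "card (\<Union>m<k - 1. completed f v m r) \<le> 1"
proof (rule card_le_Suc0_iff_eq[THEN iffD2, unfolded One_nat_def[symmetric]])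
  show "\<forall>y\<in>\<Union>m<k - 1. completed f v m r. \<forall>y'\<in>\<Union>m<k - 1. completed f v m r. y = y'"
  proof (intro ballI)
    fix y y' assume "y \<in> (\<Union>m<k - 1. completed f v m r)" "y' \<in> (\<Union>m<k - 1. completed f v m r)"
    then obtain m m' where m: "m < k - 1" "y \<in> completed f v m r" "m' < k - 1" "y' \<in> completed f v m' r"
      by auto
    have "Suc m = Suc m'"
      using completed_level[OF m(2)] completed_level[OF m(4)] m(1,3)
      by (intro GG.level_unique[of "the (f r)" v]) auto
    then show "y = y'"
      using completed_unique[OF f, of m y v r y'] m by simp
  qed
qed auto

lemma card_completed_ends:
  assumes f: "valid f"
  shows "card (\<Union>x\<in>D \<inter> dom f. completed f v (k - 1) x) \<le> card (all_ends f v D)"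
proof (rule card_inj_on_le[where f = "\<lambda>y. the (f y)"])
  show "inj_on (\<lambda>y. the (f y)) (\<Union>x\<in>D \<inter> dom f. completed f v (k - 1) x)"
    using validD(11)[OF f] completed_dom by (intro inj_onI) blast
  show "(\<lambda>y. the (f y)) ` (\<Union>x\<in>D \<inter> dom f. completed f v (k - 1) x) \<subseteq> all_ends f v D"
    using completed_ends[OF f] unfolding all_ends_def by blast
qed (rule finite_all_ends[OF f])

text \<open>Every x from which a chain is completed has just one end and a factor of at least 2; all
  other factors are at least 1.\<close>

lemma potential_ge:
  assumes f: "valid f"
  shows "2 ^ card (\<Union>x\<in>dom f - D. completed f v (k - 1) x) \<le> potential v D f"
proof -
  define X where "X = {x \<in> dom f - D. completed f v (k - 1) x \<noteq> {}}"
  have fin: "finite X" "X \<subseteq> pverts T - D"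
    using validD(2,3)[OF f] by (auto simp: X_def)
  have "card (\<Union>x\<in>dom f - D. completed f v (k - 1) x) = card (\<Union>x\<in>X. completed f v (k - 1) x)"
    by (rule arg_cong[where f = card]) (auto simp: X_def)
  also have "\<dots> \<le> (\<Sum>x\<in>X. card (completed f v (k - 1) x))"
    using fin(1) by (rule card_UN_le)
  also have "\<dots> \<le> (\<Sum>x\<in>X. 1)"
  proof (intro sum_mono)
    fix x
    show "card (completed f v (k - 1) x) \<le> 1"
      using completed_unique[OF f, of "k - 1"] k
      by (simp add: card_le_Suc0_iff_eq)
  qed
  finally have "2 ^ card (\<Union>x\<in>dom f - D. completed f v (k - 1) x) \<le> (2 :: real) ^ card X"
    by simp
  also have "\<dots> = (\<Prod>x\<in>X. 2)"
    by simp
  also have "\<dots> \<le> (\<Prod>x\<in>X. factor f v x)"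
    using completed_hit by (intro prod_mono) (fastforce simp: X_def factor_def)
  also have "\<dots> \<le> potential v D f"
    unfolding potential_def using fin(2) TT.pair_finite_verts factor_ge_1
    by (intro prod_mono2) auto
  finally show ?thesis .
qed

lemma card_occupied:
  assumes f: "valid f" and s: "s \<in> pending T r f" and v: "v = the (f s)"
  shows "card (N v \<inter> ran f) \<le> 1 + card (\<Union>x\<in>dom f. completed f v (k - 1) x)"
proof -
  let ?A = "\<Union>m<k - 1. completed f v m r" and ?B = "\<Union>x\<in>dom f. completed f v (k - 1) x"
  have "finite ?A" "finite ?B"
    using validD(3)[OF f] by auto
  have "N v \<inter> ran f \<subseteq> (\<lambda>y. the (f y)) ` (?A \<union> ?B)"
  proof
    fix w assume w: "w \<in> N v \<inter> ran f"
    then obtain y where y: "f y = Some w"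
      by (auto simp: ran_def)
    have "(w, v) \<in> parcs G"
      using w N_arc[of v w] fs_in_verts[OF f s] v GG.arcs_symmetric by blast
    then have "y \<in> ?A \<union> ?B"
      using level_1_completed[OF f s v, of y] y GG.level_1 by auto
    then show "w \<in> (\<lambda>y. the (f y)) ` (?A \<union> ?B)"
      using y by (intro image_eqI[of _ _ y]) auto
  qed
  then have "card (N v \<inter> ran f) \<le> card (?A \<union> ?B)"
    using \<open>finite ?A\<close> \<open>finite ?B\<close> surj_card_le by blast
  also have "\<dots> \<le> card ?A + card ?B"
    by (rule card_Un_le)
  also have "\<dots> \<le> 1 + card ?B"
    using card_completed_root[OF f, of v] by simp
  finally show ?thesis .
qed

section \<open>The union bound over target vertices\<close>

text \<open>The pairs in \<open>H\<close> are the tracked targets, each with the set of vertices whose chains are ignored;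
  the ignored chains contribute at most two occupied neighbours.\<close>

definition covers :: "('v \<times> 't set) set \<Rightarrow> ('t \<rightharpoonup> 'v) \<Rightarrow> bool" where
  "covers H f \<longleftrightarrow> (\<forall>v. card (all_ends f v (dom f)) \<le> 1 \<or>
     (\<exists>D. (v, D) \<in> H \<and> D \<subseteq> dom f \<and> card (all_ends f v D) \<le> 2))"

text \<open>The reciprocal of 2^(b - 2), the potential that a failure forces at a tracked target.
  The 4 pays for the two ignored ends.\<close>

definition \<kappa> :: real where "\<kappa> = 4 / 2 ^ b"

text \<open>With too few available vertices more than b neighbours are occupied, hence at least b
  are ends of completed chains. As b is at least 2, v has two ends and is tracked, and at least b -
  2 ends are not ignored.\<close>

lemma covers_available:
  assumes f: "valid f" and s: "s \<in> pending T r f" and "covers H f"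
  shows "d - b \<le> card (avail f s) \<or> (\<exists>(v, D)\<in>H. 1 \<le> \<kappa> * potential v D f)"
proof (cases "d - b \<le> card (avail f s)")
  case few: False
  define v where "v = the (f s)"
  have v_in: "v \<in> pverts G"
    using fs_in_verts[OF f s] by (simp add: v_def)
  have "card (avail f s) = d - card (N v \<inter> ran f)"
    unfolding avail_def v_def[symmetric]
    using card_Diff_subset_Int[of "N v" "ran f"] finite_N[OF v_in] card_N[OF v_in] by simp
  with few have "b < card (N v \<inter> ran f)" by linarith
  with card_occupied[OF f s v_def] have many: "b \<le> card (\<Union>x\<in>dom f. completed f v (k - 1) x)"
    by linarith
  have "\<not> card (all_ends f v (dom f)) \<le> 1"
    using many card_completed_ends[OF f, where D = "dom f" and v = v] b by simp
  with \<open>covers H f\<close> obtain D where D: "(v, D) \<in> H" "D \<subseteq> dom f" "card (all_ends f v D) \<le> 2"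
    unfolding covers_def by blast
  have "(\<Union>x\<in>dom f. completed f v (k - 1) x) =
      (\<Union>x\<in>D \<inter> dom f. completed f v (k - 1) x) \<union> (\<Union>x\<in>dom f - D. completed f v (k - 1) x)"
    by blast
  then have "card (\<Union>x\<in>dom f. completed f v (k - 1) x) \<le>
      card (\<Union>x\<in>D \<inter> dom f. completed f v (k - 1) x) + card (\<Union>x\<in>dom f - D. completed f v (k - 1) x)"
    using card_Un_le by metis
  then have "b \<le> 2 + card (\<Union>x\<in>dom f - D. completed f v (k - 1) x)"
    using many D(3) card_completed_ends[OF f, where D = D and v = v] by linarith
  then have "(2 :: real) ^ b \<le> 2 ^ (2 + card (\<Union>x\<in>dom f - D. completed f v (k - 1) x))"
    by (intro power_increasing) auto
  also have "\<dots> \<le> 4 * potential v D f"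
    using potential_ge[OF f, where D = D and v = v] by (simp add: power_add)
  finally have "1 \<le> \<kappa> * potential v D f"
    by (simp add: \<kappa>_def field_simps)
  with D(1) show ?thesis by blast
qed simp

text \<open>Contains every target at which chains from u and u' have different ends, in a form that
  can be counted.\<close>

definition candidates :: "'v \<Rightarrow> 'v \<Rightarrow> 'v set" where
  "candidates u u' = {v. \<exists>w\<in>reach (k - 1) u. \<exists>w'\<in>reach (k - 1) u'. w \<noteq> w' \<and>
     (v, w) \<in> parcs G \<and> (v, w') \<in> parcs G}"

text \<open>By \<open>common_neighbor_unique\<close> the pair of ends determines v, so there are no
  more candidates than pairs.\<close>

lemma
  assumes "u \<in> pverts G" "u' \<in> pverts G"
  shows finite_candidates: "finite (candidates u u')"
    and card_candidates: "card (candidates u u') \<le> d ^ (2 * (k - 1))"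
proof -
  let ?R = "reach (k - 1) u \<times> reach (k - 1) u'"
  let ?h = "\<lambda>(w, w'). THE v. (v, w) \<in> parcs G \<and> (v, w') \<in> parcs G"
  have sub: "candidates u u' \<subseteq> ?h ` ?R"
  proof
    fix v assume "v \<in> candidates u u'"
    then obtain w w' where w: "(w, w') \<in> ?R" "w \<noteq> w'" "(v, w) \<in> parcs G" "(v, w') \<in> parcs G"
      by (auto simp: candidates_def)
    then have "v = ?h (w, w')"
      using GG.common_neighbor_unique[OF k w(2)] by (auto intro!: the_equality[symmetric])
    then show "v \<in> ?h ` ?R"
      using w(1) by (rule image_eqI)
  qed
  have fin: "finite ?R"
    using finite_reach assms by simp
  then show "finite (candidates u u')"
    using sub finite_surj by blast
  have "card (candidates u u') \<le> card ?R"
    using sub fin surj_card_le by blast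
  also have "\<dots> \<le> d ^ (k - 1) * d ^ (k - 1)"
    unfolding card_cartesian_product using card_reach assms by (intro mult_mono) auto
  finally show "card (candidates u u') \<le> d ^ (2 * (k - 1))"
    by (simp add: power_add[symmetric] mult_2)
qed

text \<open>The potential with nothing embedded and nothing ignored. It bounds the potential of any
  target at the moment its tracking begins.\<close>

definition start :: real where "start = (\<Prod>x\<in>pverts T. 1 + wt (k - 1) x)"

text \<open>The second summand pays for the targets that are still to be added to \<open>H\<close>: each belongs to a pair of
  tree vertices that are not both embedded yet.\<close>

definition budget :: "('v \<times> 't set) set \<Rightarrow> ('t \<rightharpoonup> 'v) \<Rightarrow> real" where
  "budget H f = \<kappa> * ((\<Sum>(v, D)\<in>H. potential v D f) +
     real (card (pverts T \<times> pverts T - dom f \<times> dom f)) * real (d ^ (2 * (k - 1))) * start)"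

lemma \<kappa>_nonneg [simp]: "0 \<le> \<kappa>"
  by (simp add: \<kappa>_def)

lemma start_nonneg [simp]: "0 \<le> start"
  unfolding start_def by (intro prod_nonneg) (simp add: add_nonneg_nonneg)

lemma potential_nonneg [simp]: "0 \<le> potential v D f"
  unfolding potential_def by (intro prod_nonneg) simp

lemma budget_nonneg: "0 \<le> budget H f"
  unfolding budget_def
  by (intro mult_nonneg_nonneg add_nonneg_nonneg sum_nonneg) (auto split: prod.splits)

section \<open>Updating the tracked targets after a placement\<close>

context
  fixes f s
  assumes valid: "valid f" and s: "s \<in> pending T r f"
begin

text \<open>A target can get its second end only through a newly placed vertex, so one of x, x' is
  new. All of \<open>dom f\<close> is ignored too: this adds at most one old end and keeps the
  initial potential below \<open>start\<close>.\<close>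

definition new_entries :: "('t \<rightharpoonup> 'v) \<Rightarrow> ('v \<times> 't set) set" where
  "new_entries g = (\<Union>(x, x')\<in>(dom f \<union> TT.ch s) \<times> (dom f \<union> TT.ch s) - dom f \<times> dom f.
     (\<lambda>v. (v, dom f \<union> {x, x'})) ` candidates (the ((f ++ g) x)) (the ((f ++ g) x')))"

context
  fixes g
  assumes g: "g \<in> placements (TT.ch s) (avail f s)"
begin

lemma dom_ext: "dom (f ++ g) = dom f \<union> TT.ch s"
  by (rule ext_dom[OF valid s g])

text \<open>Only vertices that were not embedded before this placement contribute, and
  \<open>factor_le\<close> bounds them even if g has just placed them.\<close>

lemma potential_le_start:
  assumes "dom f \<subseteq> D"
  shows "potential v D (f ++ g) \<le> start"
proof -
  have "potential v D (f ++ g) \<le> (\<Prod>x\<in>pverts T - D. 1 + wt (k - 1) x)"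
    unfolding potential_def
  proof (intro prod_mono conjI)
    fix x assume "x \<in> pverts T - D"
    then have "x \<notin> dom f" using assms by blast
    then have "factor f v x = 1 + wt (k - 1) x" by (simp add: factor_def)
    then show "factor (f ++ g) v x \<le> 1 + wt (k - 1) x"
      using factor_le[OF valid s g \<open>x \<notin> dom f\<close>, of v] by simp
  qed simp
  also have "\<dots> \<le> start"
    unfolding start_def using TT.pair_finite_verts by (intro prod_mono2) auto
  finally show ?thesis .
qed

lemma ext_in_verts: "x \<in> dom f \<union> TT.ch s \<Longrightarrow> the ((f ++ g) x) \<in> pverts G"
  using validD(10)[OF valid_ext[OF valid s g]] unfolding dom_ext .

lemma finite_dom_ext: "finite (dom f \<union> TT.ch s)"
  using validD(3)[OF valid] by simp

lemma finite_new_entries: "finite (new_entries g)"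
  unfolding new_entries_def
proof (rule finite_UN_I)
  fix z assume "z \<in> (dom f \<union> TT.ch s) \<times> (dom f \<union> TT.ch s) - dom f \<times> dom f"
  then obtain x x' where z: "z = (x, x')" "x \<in> dom f \<union> TT.ch s" "x' \<in> dom f \<union> TT.ch s"
    by blast
  show "finite (case z of (x, x') \<Rightarrow>
      (\<lambda>v. (v, dom f \<union> {x, x'})) ` candidates (the ((f ++ g) x)) (the ((f ++ g) x')))"
    unfolding z(1) prod.case using ext_in_verts z(2,3)
    by (intro finite_imageI finite_candidates)
qed (use finite_dom_ext in blast)

lemma card_new_entries:
  "card (new_entries g) \<le>
    card ((dom f \<union> TT.ch s) \<times> (dom f \<union> TT.ch s) - dom f \<times> dom f) * d ^ (2 * (k - 1))"
proof -
  let ?I = "(dom f \<union> TT.ch s) \<times> (dom f \<union> TT.ch s) - dom f \<times> dom f"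
  let ?h = "\<lambda>x x'. (\<lambda>v. (v, dom f \<union> {x, x'})) ` candidates (the ((f ++ g) x)) (the ((f ++ g) x'))"
  have "card (new_entries g) \<le> (\<Sum>(x, x')\<in>?I. card (?h x x'))"
    unfolding new_entries_def using card_UN_le[of ?I "\<lambda>(x, x'). ?h x x'"] finite_dom_ext
    by (simp add: case_prod_unfold)
  also have "\<dots> \<le> (\<Sum>(x, x')\<in>?I. d ^ (2 * (k - 1)))"
  proof (rule sum_mono)
    fix z assume "z \<in> ?I"
    then obtain x x' where z: "z = (x, x')" and x: "x \<in> dom f \<union> TT.ch s" "x' \<in> dom f \<union> TT.ch s"
      by blast
    have "card (?h x x') \<le> card (candidates (the ((f ++ g) x)) (the ((f ++ g) x')))"
      using finite_candidates[OF ext_in_verts[OF x(1)] ext_in_verts[OF x(2)]]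
      by (rule card_image_le)
    also have "\<dots> \<le> d ^ (2 * (k - 1))"
      using ext_in_verts[OF x(1)] ext_in_verts[OF x(2)] by (rule card_candidates)
    finally show "(case z of (x, x') \<Rightarrow> card (?h x x')) \<le> (case z of (x, x') \<Rightarrow> d ^ (2 * (k - 1)))"
      unfolding z by simp
  qed
  finally show ?thesis by simp
qed

text \<open>Ends from \<open>dom f\<close> stay as they were, so only a target v that now gets its
  second end matters. It is a candidate for the starts of two chains with different ends, and is
  tracked from here on.\<close>

lemma covers_ext:
  assumes H: "covers H f"
  shows "covers (H \<union> new_entries g) (f ++ g)"
  unfolding covers_def
proof
  fix v
  define h where "h = f ++ g"
  have dom: "dom h = dom f \<union> TT.ch s"
    using dom_ext by (simp add: h_def)
  have old: "h x = f x" if "x \<in> dom f" for x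
    using ext_old[OF valid s g that] by (simp add: h_def)
  have h: "valid h"
    using valid_ext[OF valid s g] by (simp add: h_def)
  have same: "all_ends h v D = all_ends f v D" if "D \<subseteq> dom f" for D
    unfolding all_ends_def using that dom old by (intro SUP_cong) auto
  have "card (all_ends h v (dom h)) \<le> 1 \<or>
    (\<exists>D. (v, D) \<in> H \<union> new_entries g \<and> D \<subseteq> dom h \<and> card (all_ends h v D) \<le> 2)"
  proof (cases "card (all_ends f v (dom f)) \<le> 1")
    case False
    with H obtain D where "(v, D) \<in> H" "D \<subseteq> dom f" "card (all_ends f v D) \<le> 2"
      unfolding covers_def by blast
    then show ?thesis using same dom by auto
  next
    case True
    let ?A = "all_ends f v (dom f)" and ?A' = "all_ends h v (dom h)"
    have fin: "finite ?A" "finite ?A'"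
      using finite_all_ends valid h by auto
    have sub: "?A \<subseteq> ?A'"
      unfolding same[OF order_refl, symmetric] unfolding all_ends_def dom by blast
    show ?thesis
    proof (cases "card ?A' \<le> 1")
      case False
      \<comment> \<open>Letting w be the old end, if there is one, forces the chain to w' to start
        at a new vertex and leaves only w and w' as ignored ends.\<close>
      have "\<exists>w w'. w \<in> ?A' \<and> w' \<in> ?A' \<and> w \<noteq> w' \<and> ?A \<subseteq> {w}"
      proof (cases "?A = {}")
        case True
        then show ?thesis
          using False card_le_Suc0_iff_eq[OF fin(2)] by auto
      next
        case False
        then obtain w where "w \<in> ?A" by blast
        with True have "?A \<subseteq> {w}"
          using card_le_Suc0_iff_eq[OF fin(1)] by auto
        moreover have "?A' \<noteq> {w}"
          using \<open>\<not> card ?A' \<le> 1\<close> by auto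
        ultimately show ?thesis
          using \<open>w \<in> ?A\<close> sub by blast
      qed
      then obtain w w' where w: "w \<in> ?A'" "w' \<in> ?A'" "w \<noteq> w'" "?A \<subseteq> {w}"
        by blast
      then obtain x x' where x: "x \<in> dom h" "w \<in> ends v (k - 1) (the (h x))"
        "x' \<in> dom h" "w' \<in> ends v (k - 1) (the (h x'))"
        unfolding all_ends_def by blast
      have "x' \<notin> dom f"
      proof
        assume "x' \<in> dom f"
        then have "w' \<in> ?A"
          using x(4) old unfolding all_ends_def by auto
        with w show False by blast
      qed
      have "(v, w) \<in> parcs G" "(v, w') \<in> parcs G"
        using ends_level_1[OF x(2)] ends_level_1[OF x(4)] GG.level_1 GG.arcs_symmetric by blast+
      then have "v \<in> candidates (the (h x)) (the (h x'))"
        unfolding candidates_def using x ends_reach w(3) by blast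
      then have "(v, dom f \<union> {x, x'}) \<in> new_entries g"
        unfolding new_entries_def h_def[symmetric]
        using x(1,3) \<open>x' \<notin> dom f\<close> unfolding dom by blast
      moreover have "card (all_ends h v (dom f \<union> {x, x'})) \<le> 2"
      proof -
        have "ends v (k - 1) (the (h x)) \<subseteq> {w}" "ends v (k - 1) (the (h x')) \<subseteq> {w'}"
          using ends_unique[OF validD(10)[OF h x(1)] _ _ x(2)]
            ends_unique[OF validD(10)[OF h x(3)] _ _ x(4)] k by auto
        moreover have "all_ends h v (dom f \<union> {x, x'}) \<subseteq>
            all_ends h v (dom f) \<union> ends v (k - 1) (the (h x)) \<union> ends v (k - 1) (the (h x'))"
          unfolding all_ends_def by blast
        ultimately have "all_ends h v (dom f \<union> {x, x'}) \<subseteq> {w, w'}"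
          using w(4) unfolding same[OF order_refl] by blast
        then have "card (all_ends h v (dom f \<union> {x, x'})) \<le> card {w, w'}"
          by (intro card_mono) auto
        then show ?thesis using w(3) by simp
      qed
      ultimately show ?thesis
        using x(1,3) dom by blast
    qed simp
  qed
  then show "card (all_ends (f ++ g) v (dom (f ++ g))) \<le> 1 \<or>
    (\<exists>D. (v, D) \<in> H \<union> new_entries g \<and> D \<subseteq> dom (f ++ g) \<and> card (all_ends (f ++ g) v D) \<le> 2)"
    by (simp only: h_def)
qed

text \<open>Each pair that becomes embedded brings at most d^(2(k-1)) targets of potential at most
  \<open>start\<close>, exactly what it releases from the second summand. The first summand is left
  to be averaged over g.\<close>

lemma budget_ext:
  assumes "finite H"
  shows "budget (H \<union> new_entries g) (f ++ g) \<le>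
    \<kappa> * ((\<Sum>(v, D)\<in>H. potential v D (f ++ g)) +
     real (card (pverts T \<times> pverts T - dom f \<times> dom f)) * real (d ^ (2 * (k - 1))) * start)"
proof -
  let ?X = "dom f \<union> TT.ch s" and ?B = "real (d ^ (2 * (k - 1)))"
  let ?pot = "\<lambda>(v, D). potential v D (f ++ g)"
  have "sum ?pot (H \<union> new_entries g) \<le> sum ?pot H + sum ?pot (new_entries g)"
    using assms finite_new_entries by (subst sum_Un) (auto intro!: sum_nonneg)
  also have "sum ?pot (new_entries g) \<le> (\<Sum>_\<in>new_entries g. start)"
    by (intro sum_mono) (auto simp: new_entries_def intro!: potential_le_start)
  also have "\<dots> \<le> real (card (?X \<times> ?X - dom f \<times> dom f)) * ?B * start"
    using of_nat_mono[OF card_new_entries] start_nonneg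
    by (simp only: sum_constant of_nat_mult) (rule mult_right_mono)
  finally have pot: "sum ?pot (H \<union> new_entries g) \<le>
      sum ?pot H + real (card (?X \<times> ?X - dom f \<times> dom f)) * ?B * start"
    by simp
  have "?X \<subseteq> pverts T"
    using validD(2)[OF valid] TT.children_subset by blast
  then have split: "pverts T \<times> pverts T - dom f \<times> dom f =
      (pverts T \<times> pverts T - ?X \<times> ?X) \<union> (?X \<times> ?X - dom f \<times> dom f)"
    by blast
  have "card (pverts T \<times> pverts T - dom f \<times> dom f) =
      card (pverts T \<times> pverts T - ?X \<times> ?X) + card (?X \<times> ?X - dom f \<times> dom f)"
    unfolding split using TT.pair_finite_verts finite_dom_ext
    by (intro card_Un_disjoint finite_Diff finite_cartesian_product) blast+
  then have "real (card (pverts T \<times> pverts T - dom f \<times> dom f)) * ?B * start =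
      real (card (pverts T \<times> pverts T - ?X \<times> ?X)) * ?B * start +
      real (card (?X \<times> ?X - dom f \<times> dom f)) * ?B * start"
    by (simp add: distrib_right)
  with pot show ?thesis
    unfolding budget_def dom_ext by (intro mult_left_mono) auto
qed

end

end

section \<open>The failure probability of a whole run\<close>

lemma pending_nonempty:
  assumes f: "valid f" and "dom f \<noteq> pverts T"
  shows "pending T r f \<noteq> {}"
proof
  assume "pending T r f = {}"
  then have "pverts T \<subseteq> dom f"
    using validD(1)[OF f] by (intro TT.children_closed_verts) (auto simp: pending_def)
  with assms validD(2)[OF f] show False by blast
qed

text \<open>If a tracked potential has reached 1 / \<kappa>, the budget is at least 1 and the bound
  is trivial; this case distinction replaces a stopping time. Otherwise the step cannot fail, and
  the budget does not grow on average.\<close>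

lemma fail_prob:
  assumes sel: "\<And>f. pending T r f \<noteq> {} \<Longrightarrow> sel f \<in> pending T r f"
  shows "valid f \<Longrightarrow> finite H \<Longrightarrow> covers H f \<Longrightarrow> pmf (embed_rounds T r N sel n f) None \<le> budget H f"
proof (induction n arbitrary: f H)
  case 0
  then show ?case using budget_nonneg by simp
next
  case (Suc n)
  note f = \<open>valid f\<close>
  show ?case
  proof (cases "dom f = pverts T")
    case True
    then show ?thesis using budget_nonneg by simp
  next
    case False
    define s where "s = sel f"
    have s: "s \<in> pending T r f"
      using sel[OF pending_nonempty[OF f False]] by (simp add: s_def)
    show ?thesis
    proof (cases "\<exists>(v, D)\<in>H. 1 \<le> \<kappa> * potential v D f")
      case True
      then obtain v D where vD: "(v, D) \<in> H" "1 \<le> \<kappa> * potential v D f" by blast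
      have "pmf (embed_rounds T r N sel (Suc n) f) None \<le> 1"
        by (rule pmf_le_1)
      also note vD(2)
      also have "\<kappa> * potential v D f \<le> \<kappa> * (\<Sum>(v, D)\<in>H. potential v D f)"
        using vD(1) \<open>finite H\<close> member_le_sum[of "(v, D)" H "\<lambda>(v, D). potential v D f"]
        by (intro mult_left_mono) (auto split: prod.splits)
      also have "\<dots> \<le> budget H f"
        unfolding budget_def by (intro mult_left_mono) auto
      finally show ?thesis .
    next
      case no_bad: False
      then have av: "d - b \<le> card (avail f s)"
        using covers_available[OF f s \<open>covers H f\<close>] by blast
      let ?P = "placements (TT.ch s) (avail f s)"
      have P: "finite ?P" "?P \<noteq> {}"
        using finite_P[OF f s] P_nonempty[OF f s av] by blast+
      have "embed_rounds T r N sel (Suc n) f =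
          pmf_of_set ?P \<bind> (\<lambda>g. embed_rounds T r N sel n (f ++ g))"
        using False le_trans[OF children_bound av]
        by (simp add: embed_children_def Let_def s_def avail_def bind_map_pmf)
      then have "pmf (embed_rounds T r N sel (Suc n) f) None =
          (\<Sum>g\<in>?P. pmf (embed_rounds T r N sel n (f ++ g)) None) / card ?P"
        using P by (simp add: pmf_bind integral_pmf_of_set del: embed_rounds.simps)
      also have "\<dots> \<le> budget H f"
      proof -
        let ?R = "real (card (pverts T \<times> pverts T - dom f \<times> dom f)) * real (d ^ (2 * (k - 1))) * start"
        have "(\<Sum>g\<in>?P. pmf (embed_rounds T r N sel n (f ++ g)) None) \<le>
            (\<Sum>g\<in>?P. \<kappa> * ((\<Sum>(v, D)\<in>H. potential v D (f ++ g)) + ?R))"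
        proof (intro sum_mono)
          fix g assume g: "g \<in> ?P"
          have "pmf (embed_rounds T r N sel n (f ++ g)) None \<le>
              budget (H \<union> new_entries f s g) (f ++ g)"
            using Suc.prems valid_ext[OF f s g] covers_ext[OF f s g] finite_new_entries[OF f s g]
            by (intro Suc.IH) auto
          also have "\<dots> \<le> \<kappa> * ((\<Sum>(v, D)\<in>H. potential v D (f ++ g)) + ?R)"
            by (rule budget_ext[OF f s g \<open>finite H\<close>])
          finally show "pmf (embed_rounds T r N sel n (f ++ g)) None \<le>
              \<kappa> * ((\<Sum>(v, D)\<in>H. potential v D (f ++ g)) + ?R)" .
        qed
        also have "\<dots> = \<kappa> * ((\<Sum>g\<in>?P. \<Sum>(v, D)\<in>H. potential v D (f ++ g)) + card ?P * ?R)"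
          by (simp add: sum_distrib_left[symmetric] sum.distrib)
        finally have bound: "(\<Sum>g\<in>?P. pmf (embed_rounds T r N sel n (f ++ g)) None) \<le> \<dots>" .
        have "(\<Sum>g\<in>?P. \<Sum>(v, D)\<in>H. potential v D (f ++ g)) =
            (\<Sum>(v, D)\<in>H. \<Sum>g\<in>?P. potential v D (f ++ g))"
          by (subst sum.swap) (simp add: case_prod_unfold)
        also have "\<dots> \<le> (\<Sum>(v, D)\<in>H. card ?P * potential v D f)"
          by (intro sum_mono) (auto intro: potential_supermartingale[OF f s av])
        also have "\<dots> = card ?P * (\<Sum>(v, D)\<in>H. potential v D f)"
          by (simp add: sum_distrib_left case_prod_unfold)
        finally have "\<kappa> * ((\<Sum>g\<in>?P. \<Sum>(v, D)\<in>H. potential v D (f ++ g)) + card ?P * ?R) \<le>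
            \<kappa> * (card ?P * (\<Sum>(v, D)\<in>H. potential v D f) + card ?P * ?R)"
          by (intro mult_left_mono add_right_mono) auto
        also have "\<dots> = card ?P * budget H f"
          by (simp only: budget_def distrib_left mult.left_commute)
        finally have "(\<Sum>g\<in>?P. pmf (embed_rounds T r N sel n (f ++ g)) None) \<le> card ?P * budget H f"
          using bound by linarith
        moreover have "0 < card ?P"
          using P by (simp add: card_gt_0_iff)
        ultimately show ?thesis
          by (simp add: pos_divide_le_eq mult.commute)
      qed
      finally show ?thesis .
    qed
  qed
qed

text \<open>A pending vertex has children to embed, so each round without failure enlarges the
  domain. Starting from the root, \<open>card (pverts T)\<close> rounds would exceed the size of
  \<open>T\<close> unless the embedding is complete.\<close>

lemma embed_rounds_support:
  assumes sel: "\<And>f. pending T r f \<noteq> {} \<Longrightarrow> sel f \<in> pending T r f"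
  shows "valid f \<Longrightarrow> res \<in> set_pmf (embed_rounds T r N sel n f) \<Longrightarrow> res = None \<or>
    (\<exists>f'. res = Some f' \<and> valid f' \<and> (dom f' = pverts T \<or> card (dom f) + n \<le> card (dom f')))"
proof (induction n arbitrary: f)
  case (Suc n)
  note f = \<open>valid f\<close>
  show ?case
  proof (cases "dom f = pverts T")
    case True
    then show ?thesis using Suc.prems by simp
  next
    case False
    define s where "s = sel f"
    have s: "s \<in> pending T r f"
      using sel[OF pending_nonempty[OF f False]] by (simp add: s_def)
    let ?P = "placements (TT.ch s) (avail f s)"
    show ?thesis
    proof (cases "card (TT.ch s) \<le> card (avail f s)")
      case le: False
      then show ?thesis
        using Suc.prems(2) False by (simp add: embed_children_def Let_def s_def avail_def bind_return_pmf)
    next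
      case le: True
      have P: "finite ?P" "?P \<noteq> {}"
        using finite_P[OF f s] placements_nonempty[OF TT.finite_children finite_avail[OF f s] le] by blast+
      have "embed_rounds T r N sel (Suc n) f =
          pmf_of_set ?P \<bind> (\<lambda>g. embed_rounds T r N sel n (f ++ g))"
        using False le by (simp add: embed_children_def Let_def s_def avail_def bind_map_pmf)
      then obtain g where g: "g \<in> ?P" "res \<in> set_pmf (embed_rounds T r N sel n (f ++ g))"
        using Suc.prems(2) P by (auto simp del: embed_rounds.simps)
      have "card (dom (f ++ g)) \<ge> card (dom f) + 1"
      proof -
        have "card (dom (f ++ g)) = card (dom f) + card (TT.ch s)"
          unfolding dom_ext[OF f s g(1)] using children_fresh[OF f s] validD(3)[OF f]
          by (intro card_Un_disjoint) auto
        moreover have "0 < card (TT.ch s)"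
          using children_ne[OF f s] by (simp add: card_gt_0_iff)
        ultimately show ?thesis by simp
      qed
      then show ?thesis
        using Suc.IH[OF valid_ext[OF f s g(1)] g(2)] by fastforce
    qed
  qed
qed auto

lemma valid_root: "u \<in> pverts G \<Longrightarrow> valid [r \<mapsto> u]"
  using TT.root_in TT.root_not_child by (auto simp: valid_def)

lemma covers_root:
  assumes "u \<in> pverts G"
  shows "covers {} [r \<mapsto> u]"
proof -
  have "card (all_ends [r \<mapsto> u] v (dom [r \<mapsto> u])) \<le> 1" for v
    using ends_unique[OF assms, of "k - 1" _ v] finite_ends[OF assms, of "k - 1" v] k
    by (simp add: all_ends_def card_le_Suc0_iff_eq)
  then show ?thesis
    unfolding covers_def by blast
qed

text \<open>Every vertex is a child of at most one vertex, so passing to the children multiplies the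
  total by at most \<open>p\<close>.\<close>

lemma sum_wt_le: "(\<Sum>x\<in>pverts T. wt j x) \<le> real (card (pverts T)) * p ^ j"
proof (induction j)
  case (Suc j)
  have "(\<Sum>x\<in>pverts T. wt (Suc j) x) = (\<Sum>c\<in>(\<Union>x\<in>pverts T. TT.ch x). p * wt j c)"
    using TT.pair_finite_verts TT.parent_unique by (subst sum.UNION_disjoint) auto
  also have "\<dots> \<le> (\<Sum>c\<in>pverts T. p * wt j c)"
    using TT.pair_finite_verts TT.children_subset by (intro sum_mono2) auto
  also have "\<dots> \<le> p * (real (card (pverts T)) * p ^ j)"
    unfolding sum_distrib_left[symmetric] by (intro mult_left_mono Suc.IH) simp
  finally show ?case by (simp add: mult_ac)
qed simp

lemma start_le: "start \<le> exp (real (card (pverts T)) * p ^ (k - 1))"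
proof -
  have "start \<le> (\<Prod>x\<in>pverts T. exp (wt (k - 1) x))"
    unfolding start_def by (intro prod_mono) (auto simp: add_nonneg_nonneg)
  also have "\<dots> = exp (\<Sum>x\<in>pverts T. wt (k - 1) x)"
    using TT.pair_finite_verts by (simp add: exp_sum)
  also have "\<dots> \<le> exp (real (card (pverts T)) * p ^ (k - 1))"
    using sum_wt_le by simp
  finally show ?thesis .
qed

lemma budget_root:
  "budget {} [r \<mapsto> u] \<le> 4 / 2 ^ b * real (card (pverts T)) ^ 2 * real d ^ (2 * (k - 1)) *
     exp (real (card (pverts T)) * p ^ (k - 1))"
proof -
  have "card (pverts T \<times> pverts T - dom [r \<mapsto> u] \<times> dom [r \<mapsto> u]) \<le> card (pverts T \<times> pverts T)"
    using TT.pair_finite_verts by (intro card_mono) auto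
  then have "real (card (pverts T \<times> pverts T - dom [r \<mapsto> u] \<times> dom [r \<mapsto> u])) \<le> real (card (pverts T)) ^ 2"
    by (simp add: card_cartesian_product power2_eq_square flip: of_nat_mult)
  then have "real (card (pverts T \<times> pverts T - dom [r \<mapsto> u] \<times> dom [r \<mapsto> u])) * real (d ^ (2 * (k - 1))) * start
      \<le> real (card (pverts T)) ^ 2 * real (d ^ (2 * (k - 1))) * exp (real (card (pverts T)) * p ^ (k - 1))"
    using start_le by (intro mult_mono) auto
  then have "\<kappa> * (real (card (pverts T \<times> pverts T - dom [r \<mapsto> u] \<times> dom [r \<mapsto> u])) * real (d ^ (2 * (k - 1))) * start)
      \<le> \<kappa> * (real (card (pverts T)) ^ 2 * real (d ^ (2 * (k - 1))) * exp (real (card (pverts T)) * p ^ (k - 1)))"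
    by (intro mult_left_mono) auto
  then show ?thesis
    by (simp add: budget_def \<kappa>_def mult.assoc)
qed

section \<open>Success probability of the algorithm\<close>

lemma random_walk_last:
  "v \<in> pverts G \<Longrightarrow> ws \<in> set_pmf (random_walk N n v) \<Longrightarrow> ws \<noteq> [] \<and> last ws \<in> pverts G"
proof (induction n arbitrary: v ws)
  case (Suc n)
  have N: "finite (N v)" "N v \<noteq> {}"
    using finite_N[OF Suc.prems(1)] card_N[OF Suc.prems(1)] b by auto
  with Suc.prems(2) obtain w ws' where
    "w \<in> N v" "ws' \<in> set_pmf (random_walk N n w)" "ws = v # ws'"
    by auto
  with Suc.IH[of w ws'] N_in_verts[OF Suc.prems(1)] show ?case
    by simp
qed simp

lemma valid_embedding:
  assumes f: "valid f" and dom: "dom f = pverts T"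
  shows "is_embedding T G f"
proof -
  have arc: "(the (f x), the (f y)) \<in> parcs G" if "y \<in> TT.ch x" for x y
  proof -
    have "y \<in> dom f" "x \<in> dom f"
      using that dom TT.children_subset TT.parent_in_verts by blast+
    then show ?thesis
      using validD(8)[OF f that] validD(10)[OF f] N_arc by blast
  qed
  have "(the (f x), the (f y)) \<in> parcs G" if "(x, y) \<in> parcs T" for x y
    using TT.edge_parent[OF that] arc GG.arcs_symmetric by blast
  then show ?thesis
    unfolding is_embedding_def using validD(4,6)[OF f] dom by auto
qed

theorem success_prob:
  assumes sel: "selection_rule T r sel" and v1: "v1 \<in> pverts G"
  shows "1 - 4 / 2 ^ b * real (card (pverts T)) ^ 2 * real d ^ (2 * (k - 1)) *
      exp (real (card (pverts T)) * p ^ (k - 1))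
    \<le> measure_pmf.prob (algorithm3 T r N sel k v1)
        {res. \<exists>f. res = Some f \<and> is_embedding T G f}"
proof -
  let ?B = "4 / 2 ^ b * real (card (pverts T)) ^ 2 * real d ^ (2 * (k - 1)) *
      exp (real (card (pverts T)) * p ^ (k - 1))"
  let ?A = "algorithm3 T r N sel k v1"
  let ?run = "\<lambda>ws. embed_rounds T r N (sel ws) (card (pverts T)) [r \<mapsto> last ws]"
  have sel': "sel ws f \<in> pending T r f" if "pending T r f \<noteq> {}" for ws f
    using sel that by (simp add: selection_rule_def)
  have fail: "pmf (?run ws) None \<le> ?B" if "ws \<in> set_pmf (random_walk N (k - 1) v1)" for ws
  proof -
    have u: "last ws \<in> pverts G"
      using random_walk_last[OF v1 that] by simp
    have "pmf (?run ws) None \<le> budget {} [r \<mapsto> last ws]"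
      using fail_prob[of "sel ws", OF sel' valid_root[OF u] _ covers_root[OF u]] by simp
    also have "\<dots> \<le> ?B" by (rule budget_root)
    finally show ?thesis .
  qed
  \<comment> \<open>The bound holds for every end point of the initial walk, hence also on
    average.\<close>
  have "pmf ?A None = measure_pmf.expectation (random_walk N (k - 1) v1) (\<lambda>ws. pmf (?run ws) None)"
    by (simp add: algorithm3_def pmf_bind)
  also have "\<dots> \<le> ?B"
    using fail by (intro measure_pmf.integral_le_const measure_pmf.integrable_const_bound[where B = 1])
      (auto simp: AE_measure_pmf_iff pmf_le_1)
  finally have "1 - ?B \<le> 1 - pmf ?A None" by simp
  also have "\<dots> = measure_pmf.prob ?A (- {None})"
    using measure_pmf.prob_compl[of "{None}" ?A] by (simp add: measure_pmf_single Compl_eq_Diff_UNIV)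
  also have "\<dots> = measure_pmf.prob ?A (- {None} \<inter> set_pmf ?A)"
    by (rule measure_Int_set_pmf[symmetric])
  also have "\<dots> \<le> measure_pmf.prob ?A {res. \<exists>f. res = Some f \<and> is_embedding T G f}"
  proof (rule measure_pmf.finite_measure_mono)
    show "- {None} \<inter> set_pmf ?A \<subseteq> {res. \<exists>f. res = Some f \<and> is_embedding T G f}"
    proof
      fix res assume "res \<in> - {None} \<inter> set_pmf ?A"
      then obtain ws where ws: "ws \<in> set_pmf (random_walk N (k - 1) v1)" "res \<in> set_pmf (?run ws)"
        and "res \<noteq> None"
        by (auto simp: algorithm3_def)
      have u: "last ws \<in> pverts G"
        using random_walk_last[OF v1 ws(1)] by simp
      obtain f where f: "res = Some f" "valid f"
        "dom f = pverts T \<or> card (dom [r \<mapsto> last ws]) + card (pverts T) \<le> card (dom f)"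
        using embed_rounds_support[of "sel ws", OF sel' valid_root[OF u] ws(2)] \<open>res \<noteq> None\<close> by blast
      have "card (dom f) \<le> card (pverts T)"
        using validD(2)[OF f(2)] TT.pair_finite_verts by (intro card_mono)
      with f(3) have "dom f = pverts T" by auto
      with f show "res \<in> {res. \<exists>f. res = Some f \<and> is_embedding T G f}"
        using valid_embedding by blast
    qed
  qed simp
  finally show ?thesis .
qed

end

section \<open>Asymptotics\<close>

text \<open>With m = k - 1, the power is at least (1 - 1/k)^m = 1 / (1 + 1/m)^m, which is at least
  1/e. This absorbs the constant 1/4 in the size of the tree.\<close>

lemma inverse_4_le_power:
  fixes \<epsilon> :: real
  assumes "2 \<le> k" "\<epsilon> \<le> 1 / (2 * real k)"
  shows "1 / 4 \<le> (1 - 2 * \<epsilon>) ^ (k - 1)"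
proof -
  define m where "m = k - 1"
  have m: "0 < m" "real k = real m + 1"
    using assms(1) by (auto simp: m_def)
  have "(1 + 1 / real m) ^ m \<le> exp (1 / real m) ^ m"
    by (intro power_mono) auto
  also have "\<dots> = exp 1"
    using m(1) by (simp flip: exp_of_nat_mult)
  also have "\<dots> \<le> 4"
    using exp_le by simp
  finally have "1 / 4 \<le> 1 / (1 + 1 / real m) ^ m"
    using m(1) by (intro divide_left_mono mult_pos_pos zero_less_power add_pos_pos) auto
  also have "\<dots> = (1 - 1 / real k) ^ m"
    unfolding m(2) using m(1) by (simp add: power_one_over[symmetric] field_simps)
  also have "\<dots> \<le> (1 - 2 * \<epsilon>) ^ m"
    using assms by (intro power_mono) (auto simp: field_simps)
  finally show ?thesis by (simp add: m_def)
qed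

text \<open>The expected number of chains contributes exp (\<epsilon> d), while 2^b is at least exp
  (4 \<epsilon> d / 3) / 2. The difference of the exponents is \<epsilon> d / 3; the squared tree
  size and the number of candidates are each at most d^(2k).\<close>

lemma failure_bound:
  fixes \<epsilon> :: real
  assumes k: "2 \<le> k" and \<epsilon>: "0 < \<epsilon>" "\<epsilon> \<le> 1 / (2 * real k)"
    and t: "real t \<le> 1 / 4 * \<epsilon> * real d ^ k" and d: "0 < d"
    and b: "b = nat \<lfloor>2 * \<epsilon> * real d\<rfloor>"
  shows "4 / 2 ^ b * real t ^ 2 * real d ^ (2 * (k - 1)) * exp (real t * (1 / real (d - b)) ^ (k - 1))
    \<le> 8 * real d ^ (4 * k) * exp (- (\<epsilon> / 3 * real d))"
proof -
  have "1 / (2 * real k) \<le> 1 / 4"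
    using k by (simp add: field_simps)
  with \<epsilon> have \<epsilon>4: "\<epsilon> \<le> 1 / 4" by linarith
  have b_le: "real b \<le> 2 * \<epsilon> * real d" and b_ge: "2 * \<epsilon> * real d - 1 \<le> real b"
    using \<epsilon>(1) by (auto simp: b)
  have "2 * \<epsilon> * real d \<le> 1 / 2 * real d"
    using \<epsilon>4 by (intro mult_right_mono) auto
  with b_le d have "b < d" by linarith
  have pos: "0 < (1 - 2 * \<epsilon>) * real d"
    using \<epsilon>4 d by simp
  have db: "(1 - 2 * \<epsilon>) * real d \<le> real (d - b)"
    using b_le \<open>b < d\<close> by (simp add: algebra_simps of_nat_diff)
  have "real t * (1 / real (d - b)) ^ (k - 1) \<le>
      (1 / 4 * \<epsilon> * real d ^ k) * (1 / ((1 - 2 * \<epsilon>) * real d)) ^ (k - 1)"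
    using t db pos by (intro mult_mono power_mono divide_left_mono) auto
  also have "real d ^ k = real d * real d ^ (k - 1)"
    using k by (simp flip: power_Suc)
  also have "(1 / 4 * \<epsilon> * (real d * real d ^ (k - 1))) * (1 / ((1 - 2 * \<epsilon>) * real d)) ^ (k - 1) =
      \<epsilon> * real d * (1 / 4 / (1 - 2 * \<epsilon>) ^ (k - 1))"
    using d by (simp add: power_divide power_mult_distrib)
  also have "\<dots> \<le> \<epsilon> * real d * 1"
    using inverse_4_le_power[OF k \<epsilon>(2)] \<epsilon>(1) \<epsilon>4
    by (intro mult_left_mono) (auto simp: divide_le_eq_1)
  finally have exp_le: "exp (real t * (1 / real (d - b)) ^ (k - 1)) \<le> exp (\<epsilon> * real d)"
    by simp
  \<comment> \<open>Uses ln 2 >= 2/3. Rounding 2 \<epsilon> d down to b costs a factor 2, which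
    turns the 4 into the 8 of the conclusion.\<close>
  have "exp (2 * \<epsilon> * real d * (2 / 3)) \<le> exp (2 * \<epsilon> * real d * ln 2)"
    using ln2_ge_two_thirds \<epsilon>(1) by (subst exp_le_cancel_iff) (intro mult_left_mono, auto)
  also have "\<dots> = 2 * 2 powr (2 * \<epsilon> * real d - 1)"
    by (simp add: powr_def exp_diff algebra_simps)
  also have "\<dots> \<le> 2 * 2 powr real b"
    using b_ge by (intro mult_left_mono powr_mono) auto
  finally have pow: "exp (4 / 3 * \<epsilon> * real d) \<le> 2 * 2 ^ b"
    by (simp add: powr_realpow algebra_simps)
  have "4 / 2 ^ b = 8 / (2 * 2 ^ b :: real)"
    by simp
  also have "\<dots> \<le> 8 / exp (4 / 3 * \<epsilon> * real d)"
    using pow by (intro divide_left_mono) auto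
  finally have b4: "4 / 2 ^ b \<le> 8 / exp (4 / 3 * \<epsilon> * real d)" .
  have "1 / 4 * \<epsilon> * real d ^ k \<le> 1 * real d ^ k"
    using \<epsilon>4 by (intro mult_right_mono) auto
  with t have "real t \<le> real d ^ k" by linarith
  then have t2: "real t ^ 2 \<le> (real d ^ k) ^ 2"
    by (intro power_mono) auto
  have "4 / 2 ^ b * real t ^ 2 * real d ^ (2 * (k - 1)) * exp (real t * (1 / real (d - b)) ^ (k - 1))
      \<le> 8 / exp (4 / 3 * \<epsilon> * real d) * (real d ^ k) ^ 2 * real d ^ (2 * k) * exp (\<epsilon> * real d)"
    using b4 t2 exp_le d by (intro mult_mono power_increasing) auto
  also have "\<dots> = 8 * real d ^ (4 * k) * (exp (\<epsilon> * real d) / exp (4 / 3 * \<epsilon> * real d))"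
    by (simp add: power_mult[symmetric] power_add[symmetric] mult_ac)
  also have "exp (\<epsilon> * real d) / exp (4 / 3 * \<epsilon> * real d) = exp (- (\<epsilon> / 3 * real d))"
    by (simp add: exp_diff[symmetric] algebra_simps)
  finally show ?thesis .
qed

lemma failure_bound_tendsto_0:
  fixes c :: real
  assumes "0 < c"
  shows "(\<lambda>d. 8 * real d ^ m * exp (- (c * real d))) \<longlonglongrightarrow> 0"
proof -
  have "filterlim (\<lambda>d. c * real d) at_top sequentially"
    using assms by (intro filterlim_tendsto_pos_mult_at_top[OF tendsto_const _ filterlim_real_sequentially])
  then have "(\<lambda>d. (c * real d) ^ m / exp (c * real d)) \<longlonglongrightarrow> 0"
    using filterlim_compose[OF tendsto_power_div_exp_0] by blast
  then have "(\<lambda>d. 8 / c ^ m * ((c * real d) ^ m / exp (c * real d))) \<longlonglongrightarrow> 0"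
    by (rule tendsto_mult_right_zero)
  then show ?thesis
    using assms by (simp add: power_mult_distrib exp_minus field_simps)
qed

text \<open>The threshold \<open>d0\<close> precedes \<open>G\<close>, \<open>T\<close>,
  \<open>N\<close>, the root, the starting vertex and the selection rule, so the convergence is
  uniform in all of them.\<close>

theorem theorem4p1:
  fixes k :: nat and \<epsilon> :: real
  assumes "k \<ge> 2" and "0 < \<epsilon>" and "\<epsilon> \<le> 1 / (2 * real k)"
  shows "\<forall>\<delta>>0. \<exists>d0. \<forall>d\<ge>d0.
    \<forall>(G :: 'v pair_pre_digraph) (T :: 't pair_pre_digraph) N r v1 sel.
      pair_graph G \<and> min_degree G = d \<and> girth G = enat (2 * k + 1) \<and>
      undirected_tree T \<and>
      real (card (pverts T)) \<le> 1/4 * \<epsilon> * real d ^ k \<and>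
      real (max_degree T) \<le> real d - 2 * \<epsilon> * real d - 2 \<and>
      (\<forall>v\<in>pverts G. N v \<subseteq> neighbors G v \<and> card (N v) = d) \<and>
      r \<in> pverts T \<and> v1 \<in> pverts G \<and> selection_rule T r sel \<longrightarrow>
      measure_pmf.prob (algorithm3 T r N sel k v1)
        {res. \<exists>f. res = Some f \<and> is_embedding T G f} \<ge> 1 - \<delta>"
proof (intro allI impI)
  fix \<delta> :: real assume "0 < \<delta>"
  have "eventually (\<lambda>d. 8 * real d ^ (4 * k) * exp (- (\<epsilon> / 3 * real d)) < \<delta>) sequentially"
    using assms(2) by (intro order_tendstoD(2)[OF failure_bound_tendsto_0 \<open>0 < \<delta>\<close>]) simp
  then obtain d1 where d1: "\<And>d. d \<ge> d1 \<Longrightarrow> 8 * real d ^ (4 * k) * exp (- (\<epsilon> / 3 * real d)) < \<delta>"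
    by (auto simp: eventually_sequentially)
  \<comment> \<open>From d >= 1 / \<epsilon> follows 2 \<epsilon> d >= 2 and thus b >= 2, as needed
    to ignore two ends.\<close>
  define d0 where "d0 = max d1 (nat \<lceil>1 / \<epsilon>\<rceil>)"
  show "\<exists>d0. \<forall>d\<ge>d0.
    \<forall>(G :: 'v pair_pre_digraph) (T :: 't pair_pre_digraph) N r v1 sel.
      pair_graph G \<and> min_degree G = d \<and> girth G = enat (2 * k + 1) \<and>
      undirected_tree T \<and>
      real (card (pverts T)) \<le> 1/4 * \<epsilon> * real d ^ k \<and>
      real (max_degree T) \<le> real d - 2 * \<epsilon> * real d - 2 \<and>
      (\<forall>v\<in>pverts G. N v \<subseteq> neighbors G v \<and> card (N v) = d) \<and>
      r \<in> pverts T \<and> v1 \<in> pverts G \<and> selection_rule T r sel \<longrightarrow>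
      measure_pmf.prob (algorithm3 T r N sel k v1)
        {res. \<exists>f. res = Some f \<and> is_embedding T G f} \<ge> 1 - \<delta>"
  proof (rule exI[of _ d0], intro allI impI, elim conjE)
    fix d :: nat and G :: "'v pair_pre_digraph" and T :: "'t pair_pre_digraph" and N r v1
      and sel :: "'v list \<Rightarrow> ('t \<rightharpoonup> 'v) \<Rightarrow> 't"
    assume "d0 \<le> d" and G: "pair_graph G" and girth: "girth G = enat (2 * k + 1)"
      and T: "undirected_tree T"
      and size: "real (card (pverts T)) \<le> 1/4 * \<epsilon> * real d ^ k"
      and deg: "real (max_degree T) \<le> real d - 2 * \<epsilon> * real d - 2"
      and N: "\<forall>v\<in>pverts G. N v \<subseteq> neighbors G v \<and> card (N v) = d"
      and r: "r \<in> pverts T" and v1: "v1 \<in> pverts G" and sel: "selection_rule T r sel"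
    define b where "b = nat \<lfloor>2 * \<epsilon> * real d\<rfloor>"
    have "nat \<lceil>1 / \<epsilon>\<rceil> \<le> d" "d1 \<le> d"
      using \<open>d0 \<le> d\<close> by (auto simp: d0_def)
    then have "1 / \<epsilon> \<le> real d" by linarith
    then have "1 \<le> \<epsilon> * real d"
      using assms(2) by (simp add: field_simps)
    then have "0 < d" by (cases d) auto
    have "1 / (2 * real k) \<le> 1 / 4"
      using assms(1) by (simp add: field_simps)
    then have "2 * \<epsilon> * real d \<le> 1 / 2 * real d"
      using assms(3) by (intro mult_right_mono) auto
    have "2 \<le> b"
      using \<open>1 \<le> \<epsilon> * real d\<close> by (simp add: b_def le_nat_iff le_floor_iff)
    have b_le: "real b \<le> 2 * \<epsilon> * real d"
      using assms(2) by (simp add: b_def)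
    with \<open>2 * \<epsilon> * real d \<le> 1 / 2 * real d\<close> \<open>0 < d\<close> have "b < d" by linarith
    interpret TT: rooted_tree T r
      using T r by (intro rooted_tree.intro rooted_tree_axioms.intro) (auto simp: undirected_tree_def)
    interpret tree_embedding G k T r N d b
    proof (intro tree_embedding.intro tree_embedding_axioms.intro large_girth.intro
        large_girth_axioms.intro)
      show "card (children T r s) \<le> d - b" for s
      proof (cases "s \<in> pverts T")
        case True
        have "children T r s \<subseteq> neighbors T s"
          using TT.children_arc by (auto simp: neighbors_def)
        moreover have "finite (neighbors T s)"
          using TT.pair_finite_verts TT.in_arcsD2 by (auto simp: neighbors_def intro: finite_subset)
        ultimately have "card (children T r s) \<le> degree T s"
          unfolding degree_def by (intro card_mono)
        also have "\<dots> \<le> max_degree T"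
          unfolding max_degree_def using True TT.pair_finite_verts by (intro Max_ge) auto
        finally have "real (card (children T r s)) \<le> real d - real b"
          using deg b_le by linarith
        then show ?thesis using \<open>b < d\<close> by linarith
      next
        case False
        then have "children T r s = {}"
          using TT.parent_in_verts by blast
        then show ?thesis by simp
      qed
    qed (use G girth N assms(1) \<open>2 \<le> b\<close> \<open>b < d\<close> TT.rooted_tree_axioms in auto)
    have "4 / 2 ^ b * real (card (pverts T)) ^ 2 * real d ^ (2 * (k - 1)) *
        exp (real (card (pverts T)) * p ^ (k - 1)) \<le> \<delta>"
      unfolding p_def
      using failure_bound[OF assms size \<open>0 < d\<close> b_def] d1[OF \<open>d1 \<le> d\<close>] by linarith
    then show "1 - \<delta> \<le> measure_pmf.prob (algorithm3 T r N sel k v1)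
        {res. \<exists>f. res = Some f \<and> is_embedding T G f}"
      using success_prob[OF sel v1] by linarith
  qed
qed

end
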